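(* Let $\mathbb{K}$ be an algebraically closed field with $\operatorname{char}\mathbb{K}=0$ and let $n$ be a positive integer. Then the bracket width of the Lie algebra $\operatorname{Vec}(\mathrm{SL}_n(\mathbb{K}))$ is at most $n^2+n$.
   Context: $\mathrm{SL}_n(\mathbb{K})$ is regarded as an affine algebraic variety over $\mathbb{K}$. For an affine variety $X$ over $\mathbb{K}$, $\operatorname{Vec}(X)$ denotes the Lie algebra over $\mathbb{K}$ of (polynomial) vector fields on $X$, i.e. the $\mathbb{K}$-linear derivations of the coordinate ring $\mathbb{K}[X]$, with the commutator bracket. For a Lie algebra $L$ and $z \in [L,L]$ (the derived algebra), let $\ell(z)$ be the smallest number $m$ such that $z = \sum_{i=1}^m [x_i,y_i]$ for some $x_i,y_i \in L$. The bracket width of $L$ is $\sup\{\ell(z) : z \in [L,L]\}$. *)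

theory Defs
  imports
    "Jordan_Normal_Form.Determinant"
    "HOL-Library.Function_Algebras"
    "HOL-Library.Extended_Nat"
begin

section \<open>Lie algebras and bracket width\<close>

text \<open>The Lie algebra is a subspace L of an ambient vector space; the bracket is only required to
  behave well on L.\<close>

locale lie_algebra = vector_space scale
  for scale :: "'k::field \<Rightarrow> 'v::ab_group_add \<Rightarrow> 'v" (infixr \<open>*s\<close> 75) +
  fixes L :: "'v set" and bracket :: "'v \<Rightarrow> 'v \<Rightarrow> 'v"
  assumes subspace_carrier: "subspace L"
    and bracket_closed: "x \<in> L \<Longrightarrow> y \<in> L \<Longrightarrow> bracket x y \<in> L"
    and bracket_add_left: "x \<in> L \<Longrightarrow> y \<in> L \<Longrightarrow> z \<in> L \<Longrightarrow> bracket (x + y) z = bracket x z + bracket y z"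
    and bracket_add_right: "x \<in> L \<Longrightarrow> y \<in> L \<Longrightarrow> z \<in> L \<Longrightarrow> bracket x (y + z) = bracket x y + bracket x z"
    and bracket_scale_left: "x \<in> L \<Longrightarrow> y \<in> L \<Longrightarrow> bracket (c *s x) y = c *s bracket x y"
    and bracket_scale_right: "x \<in> L \<Longrightarrow> y \<in> L \<Longrightarrow> bracket x (c *s y) = c *s bracket x y"
    and bracket_self: "x \<in> L \<Longrightarrow> bracket x x = 0"
    and jacobi: "x \<in> L \<Longrightarrow> y \<in> L \<Longrightarrow> z \<in> L \<Longrightarrow>
      bracket x (bracket y z) + bracket y (bracket z x) + bracket z (bracket x y) = 0"
begin

definition derived_algebra :: "'v set" where
  "derived_algebra = span {bracket x y | x y. x \<in> L \<and> y \<in> L}"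

definition sum_of_brackets :: "nat \<Rightarrow> 'v \<Rightarrow> bool" where
  "sum_of_brackets m z \<longleftrightarrow>
    (\<exists>x y. (\<forall>i<m. x i \<in> L \<and> y i \<in> L) \<and> z = (\<Sum>i<m. bracket (x i) (y i)))"

definition bracket_length :: "'v \<Rightarrow> nat" where
  "bracket_length z = (LEAST m. sum_of_brackets m z)"

definition bracket_width :: enat where
  "bracket_width = (SUP z\<in>derived_algebra. enat (bracket_length z))"

text \<open>The minimum defining the length exists for every element of the derived algebra.\<close>

lemma sum_of_brackets_exists:
  assumes "z \<in> derived_algebra"
  shows "\<exists>m. sum_of_brackets m z"
  using assms unfolding derived_algebra_def
proof (induction rule: span_induct_alt)
  case base
  have "sum_of_brackets 0 0" by (simp add: sum_of_brackets_def)
  then show ?case by blast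
next
  case (step c b w)
  from step(1) obtain u v where uv: "b = bracket u v" "u \<in> L" "v \<in> L" by blast
  from step(2) obtain m :: nat and x y where
    xy: "\<forall>i<m. x i \<in> L \<and> y i \<in> L" "w = (\<Sum>i<m. bracket (x i) (y i))"
    unfolding sum_of_brackets_def by blast
  have "c *s u \<in> L" using subspace_scale[OF subspace_carrier uv(2)] .
  with uv xy have "sum_of_brackets (Suc m) (c *s b + w)"
    unfolding sum_of_brackets_def
    by (intro exI[of _ "x(m := c *s u)"] exI[of _ "y(m := v)"])
       (auto simp: less_Suc_eq bracket_scale_left add.commute intro!: sum.cong)
  then show ?case by blast
qed

end


section \<open>Coordinate rings and vector fields\<close>

text \<open>An affine space is given by its points together with the set C of its coordinate functions.\<close>

inductive_set polynomial_functions :: "('p \<Rightarrow> 'k::comm_ring_1) set \<Rightarrow> ('p \<Rightarrow> 'k) set"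
  for C :: "('p \<Rightarrow> 'k) set" where
  const: "(\<lambda>p. c) \<in> polynomial_functions C"
| coord: "f \<in> C \<Longrightarrow> f \<in> polynomial_functions C"
| add: "f \<in> polynomial_functions C \<Longrightarrow> g \<in> polynomial_functions C \<Longrightarrow> f + g \<in> polynomial_functions C"
| mult: "f \<in> polynomial_functions C \<Longrightarrow> g \<in> polynomial_functions C \<Longrightarrow> f * g \<in> polynomial_functions C"

text \<open>A function on X is represented by its extension by zero outside X, so that two polynomial
  functions are identified exactly if they agree on X, and the ring operations are the pointwise
  ones (the unit being the indicator function of X).\<close>

definition coordinate_ring :: "('p \<Rightarrow> 'k::comm_ring_1) set \<Rightarrow> 'p set \<Rightarrow> ('p \<Rightarrow> 'k) set" where
  "coordinate_ring C X = (\<lambda>f p. if p \<in> X then f p else 0) ` polynomial_functions C"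

definition fun_scale :: "'k::comm_ring_1 \<Rightarrow> ('p \<Rightarrow> 'k) \<Rightarrow> 'p \<Rightarrow> 'k" where
  "fun_scale c f = (\<lambda>p. c * f p)"

definition op_scale :: "'k::comm_ring_1 \<Rightarrow> (('p \<Rightarrow> 'k) \<Rightarrow> 'p \<Rightarrow> 'k) \<Rightarrow> ('p \<Rightarrow> 'k) \<Rightarrow> 'p \<Rightarrow> 'k" where
  "op_scale c D = (\<lambda>f. fun_scale c (D f))"

text \<open>The last condition makes a derivation of R the same thing as a total function: it fixes the
  irrelevant values outside R.\<close>

definition derivations :: "('p \<Rightarrow> 'k::comm_ring_1) set \<Rightarrow> (('p \<Rightarrow> 'k) \<Rightarrow> 'p \<Rightarrow> 'k) set" where
  "derivations R = {D.
     (\<forall>f\<in>R. D f \<in> R) \<and>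
     (\<forall>f\<in>R. \<forall>g\<in>R. D (f + g) = D f + D g) \<and>
     (\<forall>c. \<forall>f\<in>R. D (fun_scale c f) = fun_scale c (D f)) \<and>
     (\<forall>f\<in>R. \<forall>g\<in>R. D (f * g) = D f * g + f * D g) \<and>
     (\<forall>f. f \<notin> R \<longrightarrow> D f = 0)}"

definition commutator ::
    "(('p \<Rightarrow> 'k::comm_ring_1) \<Rightarrow> 'p \<Rightarrow> 'k) \<Rightarrow> (('p \<Rightarrow> 'k) \<Rightarrow> 'p \<Rightarrow> 'k) \<Rightarrow> ('p \<Rightarrow> 'k) \<Rightarrow> 'p \<Rightarrow> 'k" where
  "commutator D E = (\<lambda>f. D (E f) - E (D f))"

definition Vec :: "('p \<Rightarrow> 'k::comm_ring_1) set \<Rightarrow> 'p set \<Rightarrow> (('p \<Rightarrow> 'k) \<Rightarrow> 'p \<Rightarrow> 'k) set" where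
  "Vec C X = derivations (coordinate_ring C X)"

lemma coordinate_ring_add:
  assumes "f \<in> coordinate_ring C X" "g \<in> coordinate_ring C X"
  shows "f + g \<in> coordinate_ring C X"
proof -
  obtain f' g' where fg: "f' \<in> polynomial_functions C" "g' \<in> polynomial_functions C"
    "f = (\<lambda>p. if p \<in> X then f' p else 0)" "g = (\<lambda>p. if p \<in> X then g' p else 0)"
    using assms unfolding coordinate_ring_def by blast
  then have "f + g = (\<lambda>p. if p \<in> X then (f' + g') p else 0)" by auto
  with fg show ?thesis
    unfolding coordinate_ring_def
    by (intro image_eqI[OF _ polynomial_functions.add[OF fg(1,2)]]) simp
qed

lemma coordinate_ring_mult:
  assumes "f \<in> coordinate_ring C X" "g \<in> coordinate_ring C X"
  shows "f * g \<in> coordinate_ring C X"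
proof -
  obtain f' g' where fg: "f' \<in> polynomial_functions C" "g' \<in> polynomial_functions C"
    "f = (\<lambda>p. if p \<in> X then f' p else 0)" "g = (\<lambda>p. if p \<in> X then g' p else 0)"
    using assms unfolding coordinate_ring_def by blast
  then have "f * g = (\<lambda>p. if p \<in> X then (f' * g') p else 0)" by auto
  with fg show ?thesis
    unfolding coordinate_ring_def
    by (intro image_eqI[OF _ polynomial_functions.mult[OF fg(1,2)]]) simp
qed

lemma coordinate_ring_scale:
  assumes "f \<in> coordinate_ring C X"
  shows "fun_scale c f \<in> coordinate_ring C X"
proof -
  have "(\<lambda>p. if p \<in> X then c else 0) \<in> coordinate_ring C X"
    unfolding coordinate_ring_def by (rule image_eqI[OF _ polynomial_functions.const[of c]]) simp
  from coordinate_ring_mult[OF this assms]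
  have "(\<lambda>p. if p \<in> X then c else 0) * f \<in> coordinate_ring C X" .
  moreover have "(\<lambda>p. if p \<in> X then c else 0) * f = fun_scale c f"
    using assms by (auto simp: fun_scale_def coordinate_ring_def)
  ultimately show ?thesis by simp
qed

lemma coordinate_ring_0: "0 \<in> coordinate_ring C X"
  unfolding coordinate_ring_def
  by (rule image_eqI[OF _ polynomial_functions.const[of 0]]) auto

lemma coordinate_ring_diff:
  assumes "f \<in> coordinate_ring C X" "g \<in> coordinate_ring C X"
  shows "f - g \<in> coordinate_ring C X"
proof -
  have "f - g = f + fun_scale (- 1) g" by (auto simp: fun_scale_def)
  then show ?thesis by (simp only: coordinate_ring_add coordinate_ring_scale assms)
qed

lemma Vec_0_diff:
  assumes D: "D \<in> Vec C X"
  shows "D 0 = 0"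
    and "f \<in> coordinate_ring C X \<Longrightarrow> g \<in> coordinate_ring C X \<Longrightarrow> D (f - g) = D f - D g"
proof -
  show "D 0 = 0"
  proof -
    have "D (0 + 0) = D 0 + D 0"
      using D coordinate_ring_0 unfolding Vec_def derivations_def by blast
    then show ?thesis by simp
  qed
  assume fg: "f \<in> coordinate_ring C X" "g \<in> coordinate_ring C X"
  have "D ((f - g) + g) = D (f - g) + D g"
    using D fg coordinate_ring_diff unfolding Vec_def derivations_def by blast
  then show "D (f - g) = D f - D g" by simp
qed

lemma commutator_Vec:
  assumes "D \<in> Vec C X" "E \<in> Vec C X"
  shows "commutator D E \<in> Vec C X"
proof -
  let ?R = "coordinate_ring C X"
  have D: "\<And>f. f \<in> ?R \<Longrightarrow> D f \<in> ?R" "\<And>f g. f \<in> ?R \<Longrightarrow> g \<in> ?R \<Longrightarrow> D (f + g) = D f + D g"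
    "\<And>c f. f \<in> ?R \<Longrightarrow> D (fun_scale c f) = fun_scale c (D f)"
    "\<And>f g. f \<in> ?R \<Longrightarrow> g \<in> ?R \<Longrightarrow> D (f * g) = D f * g + f * D g" "\<And>f. f \<notin> ?R \<Longrightarrow> D f = 0"
    using assms(1) by (auto simp: Vec_def derivations_def)
  have E: "\<And>f. f \<in> ?R \<Longrightarrow> E f \<in> ?R" "\<And>f g. f \<in> ?R \<Longrightarrow> g \<in> ?R \<Longrightarrow> E (f + g) = E f + E g"
    "\<And>c f. f \<in> ?R \<Longrightarrow> E (fun_scale c f) = fun_scale c (E f)"
    "\<And>f g. f \<in> ?R \<Longrightarrow> g \<in> ?R \<Longrightarrow> E (f * g) = E f * g + f * E g" "\<And>f. f \<notin> ?R \<Longrightarrow> E f = 0"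
    using assms(2) by (auto simp: Vec_def derivations_def)
  have "commutator D E (f * g) = commutator D E f * g + f * commutator D E g"
    if "f \<in> ?R" "g \<in> ?R" for f g
    using that by (simp add: commutator_def D E coordinate_ring_mult) (simp add: fun_eq_iff algebra_simps)
  then show ?thesis
    unfolding Vec_def derivations_def
    by (auto simp: commutator_def D E coordinate_ring_diff Vec_0_diff(1)[OF assms(1)]
        Vec_0_diff(1)[OF assms(2)]) (auto simp: fun_scale_def algebra_simps fun_eq_iff)
qed

lemma lie_algebra_Vec:
  fixes C :: "('p \<Rightarrow> 'k::field) set"
  shows "lie_algebra op_scale (Vec C X) commutator"
proof -
  interpret vector_space "op_scale :: 'k \<Rightarrow> (('p \<Rightarrow> 'k) \<Rightarrow> 'p \<Rightarrow> 'k) \<Rightarrow> _"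
    by unfold_locales (auto simp: op_scale_def fun_scale_def fun_eq_iff algebra_simps)
  have sub: "subspace (Vec C X)"
    unfolding subspace_def
  proof (intro conjI ballI allI)
    show "0 \<in> Vec C X"
      by (auto simp: Vec_def derivations_def coordinate_ring_0 fun_scale_def fun_eq_iff)
  next
    fix D E assume "D \<in> Vec C X" "E \<in> Vec C X"
    then show "D + E \<in> Vec C X"
      by (simp add: Vec_def derivations_def coordinate_ring_add)
        (auto simp: fun_scale_def fun_eq_iff algebra_simps)
  next
    fix c D assume "D \<in> Vec C X"
    then show "op_scale c D \<in> Vec C X"
      by (simp add: Vec_def derivations_def op_scale_def coordinate_ring_scale)
        (auto simp: fun_scale_def fun_eq_iff algebra_simps)
  qed
  have lin: "D (E f + F f) = D (E f) + D (F f)" "D (E f - F f) = D (E f) - D (F f)"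
      "D (fun_scale c (E f)) = fun_scale c (D (E f))"
    if "D \<in> Vec C X" "E \<in> Vec C X" "F \<in> Vec C X" for D E F f c
  proof -
    have cl: "G f \<in> coordinate_ring C X" if "G \<in> Vec C X" for G
      using that coordinate_ring_0 unfolding Vec_def derivations_def
      by (cases "f \<in> coordinate_ring C X") auto
    have "E f \<in> coordinate_ring C X" "F f \<in> coordinate_ring C X" using cl that by blast+
    with that(1) show "D (E f + F f) = D (E f) + D (F f)"
      "D (E f - F f) = D (E f) - D (F f)"
      "D (fun_scale c (E f)) = fun_scale c (D (E f))"
      by (auto simp: Vec_0_diff(2)[OF that(1)]) (auto simp: Vec_def derivations_def)
  qed
  have scale_diff: "fun_scale c (f - g) = fun_scale c f - fun_scale c g" for c and f g :: "'p \<Rightarrow> 'k"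
    by (auto simp: fun_scale_def algebra_simps)
  show ?thesis
  proof (unfold_locales)
    fix D E F assume *: "D \<in> Vec C X" "E \<in> Vec C X" "F \<in> Vec C X"
    show "commutator (D + E) F = commutator D F + commutator E F"
      by (intro ext) (simp add: commutator_def lin *)
    show "commutator D (E + F) = commutator D E + commutator D F"
      by (intro ext) (simp add: commutator_def lin *)
    have l2: "A (B (G f) - H (K f)) = A (B (G f)) - A (H (K f))"
      if "A \<in> Vec C X" "B \<in> Vec C X" "G \<in> Vec C X" "H \<in> Vec C X" "K \<in> Vec C X" for A B G H K f
    proof -
      have "G' g \<in> coordinate_ring C X" if "G' \<in> Vec C X" for G' g
        using that coordinate_ring_0 unfolding Vec_def derivations_def
        by (cases "g \<in> coordinate_ring C X") auto
      then show ?thesis using that by (intro Vec_0_diff(2)) auto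
    qed
    show "commutator D (commutator E F) + commutator E (commutator F D) +
        commutator F (commutator D E) = 0"
      by (intro ext) (simp add: commutator_def l2 *)
  next
    fix c D E assume *: "D \<in> Vec C X" "E \<in> Vec C X"
    show "commutator (op_scale c D) E = op_scale c (commutator D E)"
      by (rule ext) (simp add: commutator_def op_scale_def lin[OF *(2,1,1)] scale_diff)
    show "commutator D (op_scale c E) = op_scale c (commutator D E)"
      by (rule ext) (simp add: commutator_def op_scale_def lin[OF *(1,2,2)] scale_diff)
  next
    fix D show "commutator D D = 0" by (auto simp: commutator_def)
  qed (use sub commutator_Vec in auto)
qed


section \<open>The special linear group as an affine variety\<close>

definition SL :: "nat \<Rightarrow> 'k::comm_ring_1 mat set" where
  "SL n = {A \<in> carrier_mat n n. det A = 1}"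

definition matrix_entries :: "nat \<Rightarrow> ('k mat \<Rightarrow> 'k) set" where
  "matrix_entries n = {\<lambda>A. A $$ (i, j) | i j. i < n \<and> j < n}"

definition Vec_SL :: "nat \<Rightarrow> (('k::comm_ring_1 mat \<Rightarrow> 'k) \<Rightarrow> 'k mat \<Rightarrow> 'k) set" where
  "Vec_SL n = Vec (matrix_entries n) (SL n)"

lemma lie_algebra_Vec_SL:
  "lie_algebra op_scale (Vec_SL n :: (('k::field mat \<Rightarrow> 'k) \<Rightarrow> 'k mat \<Rightarrow> 'k) set) commutator"
  unfolding Vec_SL_def by (rule lie_algebra_Vec)

end

theory Submission
  imports Defs
begin

text \<open>The fields given by column operations commute with the fields \<open>L\<^sub>i\<^sub>j\<close> given by row operations, and
  together with their brackets they form a frame: every vector field is \<open>\<Sum> F\<^sub>q R\<^sub>q\<close>. Since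
  \<open>[L\<^sub>i\<^sub>j, g R\<^sub>q] = L\<^sub>i\<^sub>j(g) R\<^sub>q\<close>, it suffices to write each regular function as a constant plus
  \<open>\<Sum> L\<^sub>i\<^sub>j(g\<^sub>i\<^sub>j)\<close> over \<open>i \<noteq> j\<close>; this costs \<open>n\<^sup>2 - n\<close> brackets, whatever the number of frame fields.
  The remaining combination of the \<open>R\<^sub>q\<close> with constant coefficients costs \<open>n\<close> more: one for its
  off-diagonal part, by bracketing with a regular element of the torus, and \<open>n - 1\<close> for its
  diagonal part.

  The splitting of functions is the Capelli argument. Modulo the images of the \<open>L\<^sub>i\<^sub>j\<close>, a monomial of
  positive degree is a nonzero rational multiple of a sum of its antisymmetrisations in the row
  indices, and each of these is a multiple of the determinant, hence on \<open>SL\<^sub>n\<close> a scalar times a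
  monomial of smaller degree.\<close>

section \<open>Antisymmetrisation modulo row replacements\<close>

text \<open>A word \<open>r\<close> lists the row indices of the factors of a monomial. Its partial antisymmetrisation \<open>G m S\<close>
  permutes the letters \<open>0, \<dots>, m - 1\<close> placed at the positions in \<open>S\<close>. Splitting the permutations of
  \<open>{0, \<dots>, m}\<close> by the image of \<open>m\<close> and applying the relation \<open>shift\<close> to the nontrivial
  transpositions gives \<open>(\<Sum>u. G (m + 1) (S \<union> {u})) \<equiv> (card U + m) G m S\<close>, where \<open>u\<close> ranges over the set \<open>U\<close>
  of positions of the letter \<open>m\<close>; so one descends from \<open>m = n\<close>, the relation \<open>alt\<close>, to \<open>m = 0\<close>, the word itself.\<close>

lemma alternating_relations_span:
  fixes scale :: "'k::field_char_0 \<Rightarrow> 'v::ab_group_add \<Rightarrow> 'v" and \<phi> :: "('i \<Rightarrow> nat) \<Rightarrow> 'v"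
  assumes "vector_space scale" and W: "module.subspace scale W"
    and I: "finite I" "I \<noteq> {}"
    and shift: "\<And>r i j. r \<in> I \<rightarrow> {..<n} \<Longrightarrow> i < n \<Longrightarrow> j < n \<Longrightarrow> i \<noteq> j \<Longrightarrow>
      (\<Sum>t | t \<in> I \<and> r t = j. \<phi> (r(t := i))) \<in> W"
    and alt: "\<And>r S. r \<in> I \<rightarrow> {..<n} \<Longrightarrow> S \<subseteq> I \<Longrightarrow> bij_betw r S {..<n} \<Longrightarrow>
      (\<Sum>\<sigma> | \<sigma> permutes {..<n}. scale (of_int (sign \<sigma>)) (\<phi> (\<lambda>t. if t \<in> S then \<sigma> (r t) else r t))) \<in> W"
    and r: "r \<in> I \<rightarrow> {..<n}"
  shows "\<phi> r \<in> W"
proof (cases "\<exists>t\<in>I. r t = 0")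
  case False
  \<comment> \<open>The word \<open>r(s := 0)\<close> has its only letter \<open>0\<close> at
    \<open>s\<close>, so replacing \<open>0\<close> by \<open>r s\<close> gives a relation with the
    single term \<open>\<phi> r\<close>.\<close>
  obtain s where s: "s \<in> I" using I by blast
  have n: "0 < n" "r s < n" "r s \<noteq> 0" using r s False by fastforce+
  have "{t. t \<in> I \<and> (r(s := 0)) t = 0} = {s}" using False s by auto
  moreover have "r(s := 0) \<in> I \<rightarrow> {..<n}" using r n by auto
  ultimately show ?thesis using shift[of "r(s := 0)" "r s" 0] n by simp
next
  case True
  interpret vector_space scale by fact
  define G where "G m S = (\<Sum>\<sigma> | \<sigma> permutes {..<m}. scale (of_int (sign \<sigma>))
      (\<phi> (\<lambda>t. if t \<in> S then \<sigma> (r t) else r t)))" for m S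
  have "\<forall>S. S \<subseteq> I \<longrightarrow> bij_betw r S {..<m} \<longrightarrow> G m S \<in> W" if "m \<le> n" for m
    using that
  proof (induction rule: inc_induct)
    case base
    then show ?case using alt[OF r] by (simp add: G_def)
  next
    case (step m)
    show ?case
    proof (intro allI impI)
      fix S assume S: "S \<subseteq> I" "bij_betw r S {..<m}"
      define U where "U = {u \<in> I. r u = m}"
      have finU: "finite U" using I by (simp add: U_def)
      have US: "u \<notin> S" if "u \<in> U" for u
        using that S(2) by (auto simp: U_def bij_betw_def)
      define P where "P = {q. q permutes {..<m}}"
      have finP: "finite P" by (simp add: P_def finite_permutations)
      \<comment> \<open>\<open>w q\<close> permutes the letters below \<open>m\<close> by
        \<open>q\<close>; \<open>v q b\<close> moreover writes \<open>m\<close> at the position of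
        \<open>S\<close> where \<open>w q\<close> has the letter \<open>b\<close>. Writing
        \<open>b\<close> at some \<open>u\<close> in \<open>U\<close> then amounts to composing
        \<open>q\<close> with the transposition of \<open>m\<close> and \<open>b\<close>.\<close>
      define w where "w q = (\<lambda>t. if t \<in> S then q (r t) else r t)" for q
      define v where "v q b = (w q)(inv_into S r (Hilbert_Choice.inv q b) := m)" for q b
      have Sin: "inv_into S r (Hilbert_Choice.inv q b) \<in> S" "r (inv_into S r (Hilbert_Choice.inv q b)) = Hilbert_Choice.inv q b"
        if "q \<in> P" "b < m" for q b
      proof -
        have "Hilbert_Choice.inv q b < m" using that permutes_in_image[OF permutes_inv, of q "{..<m}" b] by (auto simp: P_def)
        then have "Hilbert_Choice.inv q b \<in> r ` S" using S(2) by (auto simp: bij_betw_def)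
        then show "inv_into S r (Hilbert_Choice.inv q b) \<in> S" "r (inv_into S r (Hilbert_Choice.inv q b)) = Hilbert_Choice.inv q b"
          by (auto intro: inv_into_into f_inv_into_f)
      qed
      have w_range: "w q \<in> I \<rightarrow> {..<n}" if "q \<in> P" for q
      proof
        fix t assume t: "t \<in> I"
        have "q (r t) < m" if "t \<in> S"
          using that S(2) \<open>q \<in> P\<close> permutes_in_image[of q "{..<m}" "r t"] by (auto simp: P_def bij_betw_def)
        then show "w q t \<in> {..<n}" using t r step(1,2) by (auto simp: w_def intro: less_trans)
      qed
      \<comment> \<open>This is \<open>shift\<close> for \<open>v q b\<close>, whose letters
        \<open>m\<close> sit at \<open>U\<close> and at one position of \<open>S\<close>; restoring
        \<open>b\<close> at the latter gives back \<open>w q\<close>.\<close>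
      have rel: "(\<Sum>u\<in>U. \<phi> ((v q b)(u := b))) + \<phi> (w q) \<in> W" if q: "q \<in> P" and b: "b < m" for q b
      proof -
        let ?t = "inv_into S r (Hilbert_Choice.inv q b)"
        note t = Sin[OF q b]
        have qb: "q (Hilbert_Choice.inv q b) = b" using q by (metis P_def mem_Collect_eq permutes_inverses(1))
        have "{t. t \<in> I \<and> v q b t = m} = insert ?t U"
        proof -
          have "q (r t) < m" if "t \<in> S" for t
            using that S(2) q permutes_in_image[of q "{..<m}" "r t"] by (auto simp: P_def bij_betw_def)
          then have "v q b s = m \<longleftrightarrow> s = ?t \<or> s \<in> U" if "s \<in> I" for s
            using that t US[of s] by (cases "s = ?t"; cases "s \<in> S") (auto simp: v_def w_def U_def)
          moreover have "?t \<in> I" "U \<subseteq> I" using t S by (auto simp: U_def)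
          ultimately show ?thesis by blast
        qed
        moreover have "v q b \<in> I \<rightarrow> {..<n}"
          using w_range[OF q] step(1,2) by (auto simp: v_def)
        ultimately have "(\<Sum>t\<in>insert ?t U. \<phi> ((v q b)(t := b))) \<in> W"
          using shift[of "v q b" b m] b step(1,2) by simp
        moreover have "?t \<notin> U" using US t by blast
        moreover have "(v q b)(?t := b) = w q" using t qb by (auto simp: v_def w_def fun_eq_iff)
        ultimately show ?thesis using finU by (simp add: add.commute)
      qed
      \<comment> \<open>Each permutation of \<open>{..<Suc m}\<close> is
        \<open>transpose m b \<circ> q\<close> for a unique \<open>b \<le> m\<close> and a unique
        permutation \<open>q\<close> of \<open>{..<m}\<close>; for \<open>b < m\<close> the sign
        changes.\<close>
      have expand: "G (Suc m) (insert u S) = (\<Sum>q\<in>P. scale (of_int (sign q)) (\<phi> (w q)))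
          - (\<Sum>q\<in>P. \<Sum>b<m. scale (of_int (sign q)) (\<phi> ((v q b)(u := b))))" if u: "u \<in> U" for u
      proof -
        have ru: "r u = m" "u \<in> I" using u by (auto simp: U_def)
        define f where "f \<sigma> = scale (of_int (sign \<sigma>)) (\<phi> (\<lambda>t. if t \<in> insert u S then \<sigma> (r t) else r t))" for \<sigma>
        have "G (Suc m) (insert u S) = sum f {p. p permutes insert m {..<m}}"
          by (simp add: G_def f_def lessThan_Suc)
        also have "\<dots> = (\<Sum>b\<in>insert m {..<m}. \<Sum>q\<in>P. f (transpose m b \<circ> q))"
          unfolding P_def by (rule sum_over_permutations_insert) auto
        also have "\<dots> = (\<Sum>q\<in>P. f q) + (\<Sum>b<m. \<Sum>q\<in>P. f (transpose m b \<circ> q))"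
          by simp
        also have "(\<Sum>q\<in>P. f q) = (\<Sum>q\<in>P. scale (of_int (sign q)) (\<phi> (w q)))"
        proof (rule sum.cong[OF refl])
          fix q assume "q \<in> P"
          then have "q m = m" by (auto simp: P_def permutes_def)
          then have "(\<lambda>t. if t \<in> insert u S then q (r t) else r t) = w q"
            using ru by (auto simp: w_def)
          then show "f q = scale (of_int (sign q)) (\<phi> (w q))" by (simp add: f_def)
        qed
        also have "(\<Sum>b<m. \<Sum>q\<in>P. f (transpose m b \<circ> q)) =
            (\<Sum>b<m. \<Sum>q\<in>P. - scale (of_int (sign q)) (\<phi> ((v q b)(u := b))))"
        proof (intro sum.cong refl)
          fix b q assume b: "b \<in> {..<m}" and q: "q \<in> P"
          then have bm: "b < m" by simp
          have q': "q permutes {..<m}" using q by (simp add: P_def)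
          have qm: "q m = m" using q' by (auto simp: permutes_def)
          note t = Sin[OF q bm]
          have qb: "q (Hilbert_Choice.inv q b) = b" using q' by (metis permutes_inverses(1))
          have eq: "q (r t) = b \<longleftrightarrow> t = inv_into S r (Hilbert_Choice.inv q b)" if "t \<in> S" for t
          proof -
            have "q (r t) = b \<longleftrightarrow> r t = Hilbert_Choice.inv q b"
              using q' by (metis permutes_inverses)
            also have "\<dots> \<longleftrightarrow> t = inv_into S r (Hilbert_Choice.inv q b)"
              using that t S(2) by (metis bij_betw_def inv_into_f_f)
            finally show ?thesis .
          qed
          have lt: "q (r t) < m" if "t \<in> S" for t
            using that S(2) permutes_in_image[OF q', of "r t"] by (auto simp: bij_betw_def)
          have "(\<lambda>t. if t \<in> insert u S then (transpose m b \<circ> q) (r t) else r t) = (v q b)(u := b)"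
          proof
            fix t
            show "(if t \<in> insert u S then (transpose m b \<circ> q) (r t) else r t) = ((v q b)(u := b)) t"
              using ru qm US[OF u] t eq[of t] lt[of t]
              by (auto simp: v_def w_def transpose_def)
          qed
          moreover have "sign (transpose m b \<circ> q) = - sign q"
            using bm q' by (subst sign_compose)
              (auto simp: sign_swap_id permutation_swap_id intro: permutation_permutes[THEN iffD2] exI[of _ "{..<m}"])
          ultimately show "f (transpose m b \<circ> q) = - scale (of_int (sign q)) (\<phi> ((v q b)(u := b)))"
            by (simp add: f_def)
        qed
        also have "\<dots> = - (\<Sum>q\<in>P. \<Sum>b<m. scale (of_int (sign q)) (\<phi> ((v q b)(u := b))))"
          by (subst sum.swap) (simp add: sum_negf)
        finally show ?thesis by simp
      qed
      have inW: "(\<Sum>u\<in>U. G (Suc m) (insert u S)) \<in> W"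
      proof (rule subspace_sum[OF W])
        fix u assume u: "u \<in> U"
        have "bij_betw r (insert u S) {..<Suc m}"
          using S(2) US[OF u] u bij_betw_combine[of r "{u}" "{m}" S "{..<m}"]
          by (auto simp: U_def lessThan_Suc bij_betw_def)
        then show "G (Suc m) (insert u S) \<in> W" using step(3) S(1) u by (auto simp: U_def)
      qed
      have G: "G m S = (\<Sum>q\<in>P. scale (of_int (sign q)) (\<phi> (w q)))"
        by (simp add: G_def P_def w_def)
      have "(\<Sum>u\<in>U. G (Suc m) (insert u S)) = scale (of_nat (card U)) (G m S)
          - (\<Sum>u\<in>U. \<Sum>q\<in>P. \<Sum>b<m. scale (of_int (sign q)) (\<phi> ((v q b)(u := b))))"
        by (simp add: expand G sum_subtractf sum_constant_scale)
      also have "(\<Sum>u\<in>U. \<Sum>q\<in>P. \<Sum>b<m. scale (of_int (sign q)) (\<phi> ((v q b)(u := b)))) =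
          (\<Sum>q\<in>P. \<Sum>b<m. scale (of_int (sign q)) (\<Sum>u\<in>U. \<phi> ((v q b)(u := b))))"
        by (subst sum.swap, rule sum.cong[OF refl], subst sum.swap) (simp add: scale_sum_right)
      \<comment> \<open>Adding \<open>\<phi> (w q)\<close> completes each inner sum to the relation
        \<open>rel\<close>; over the \<open>m\<close> values of \<open>b\<close> this adds
        \<open>m\<close> copies of \<open>G m S\<close>.\<close>
      also have "\<dots> = (\<Sum>q\<in>P. \<Sum>b<m. scale (of_int (sign q)) ((\<Sum>u\<in>U. \<phi> ((v q b)(u := b))) + \<phi> (w q)))
          - scale (of_nat m) (G m S)"
      proof -
        have "(\<Sum>b<m. scale (of_int (sign q)) (\<phi> (w q))) = scale (of_nat m) (scale (of_int (sign q)) (\<phi> (w q)))"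
          for q by (simp only: sum_constant_scale card_lessThan)
        then have "scale (of_nat m) (G m S) = (\<Sum>q\<in>P. \<Sum>b<m. scale (of_int (sign q)) (\<phi> (w q)))"
          by (simp only: G scale_sum_right)
        then show ?thesis
          by (simp only: scale_right_distrib sum.distrib add_diff_cancel_right')
      qed
      finally have "scale (of_nat (card U + m)) (G m S) = (\<Sum>u\<in>U. G (Suc m) (insert u S)) +
          (\<Sum>q\<in>P. \<Sum>b<m. scale (of_int (sign q)) ((\<Sum>u\<in>U. \<phi> ((v q b)(u := b))) + \<phi> (w q)))"
        by (simp only: of_nat_add scale_left_distrib diff_diff_eq2 diff_add_cancel)
      also have "\<dots> \<in> W"
        by (intro subspace_add[OF W] inW subspace_sum[OF W] subspace_scale[OF W] rel) auto
      finally have "scale (inverse (of_nat (card U + m))) (scale (of_nat (card U + m)) (G m S)) \<in> W"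
        by (rule subspace_scale[OF W])
      \<comment> \<open>For \<open>m = 0\<close> the set \<open>U\<close> holds the positions of the
        letter \<open>0\<close>, which occurs by the case assumption. Characteristic zero then
        permits the division.\<close>
      moreover have "card U + m \<noteq> 0"
        using True finU by (cases m) (auto simp: U_def)
      then have "of_nat (card U + m) \<noteq> (0 :: 'k)" by (simp only: of_nat_eq_0_iff simp_thms)
      ultimately show "G m S \<in> W" by (simp only: scale_scale left_inverse scale_one not_False_eq_True)
    qed
  qed
  from this[of 0] have "G 0 {} \<in> W" by (simp add: bij_betw_def)
  moreover have "{\<sigma>. \<sigma> permutes ({} :: nat set)} = {id}" by auto
  ultimately show ?thesis by (simp add: G_def)
qed

section \<open>Derivations of coordinate rings\<close>

lemma sum_fun_apply: "(\<Sum>a\<in>A. f a) x = (\<Sum>a\<in>A. f a x)"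
  by (induction A rule: infinite_finite_induct) auto

lemma prod_fun_apply: "(\<Prod>a\<in>A. f a) x = (\<Prod>a\<in>A. f a x)"
  by (induction A rule: infinite_finite_induct) auto

section \<open>Functions on an affine variety as extensions by zero\<close>

definition restr :: "'p set \<Rightarrow> ('p \<Rightarrow> 'k::zero) \<Rightarrow> 'p \<Rightarrow> 'k" where
  "restr X f = (\<lambda>p. if p \<in> X then f p else 0)"

lemma coordinate_ring_eq: "coordinate_ring C X = restr X ` polynomial_functions C"
  by (simp add: coordinate_ring_def restr_def)

lemma coordinate_ring_const: "restr X (\<lambda>_. c) \<in> coordinate_ring C X"
  by (simp add: coordinate_ring_eq polynomial_functions.const)

lemma coordinate_ring_coord: "f \<in> C \<Longrightarrow> restr X f \<in> coordinate_ring C X"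
  by (simp add: coordinate_ring_eq polynomial_functions.coord)

text \<open>Extension by zero respects sums and products, so induction over polynomial functions
  descends to their restrictions.\<close>

lemma coordinate_ring_induct [consumes 1, case_names const coord add mult]:
  assumes "f \<in> coordinate_ring C X"
    and "\<And>c. P (restr X (\<lambda>_. c))"
    and "\<And>f. f \<in> C \<Longrightarrow> P (restr X f)"
    and "\<And>f g. f \<in> coordinate_ring C X \<Longrightarrow> g \<in> coordinate_ring C X \<Longrightarrow> P f \<Longrightarrow> P g \<Longrightarrow> P (f + g)"
    and "\<And>f g. f \<in> coordinate_ring C X \<Longrightarrow> g \<in> coordinate_ring C X \<Longrightarrow> P f \<Longrightarrow> P g \<Longrightarrow> P (f * g)"
  shows "P f"
proof -
  have "P (restr X f')" if "f' \<in> polynomial_functions C" for f'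
    using that
  proof (induction rule: polynomial_functions.induct)
    case (add f g)
    have "restr X (f + g) = restr X f + restr X g" by (auto simp: restr_def)
    then show ?case using add assms(4)[of "restr X f" "restr X g"] by (simp add: coordinate_ring_eq plus_fun_def)
  next
    case (mult f g)
    have "restr X (f * g) = restr X f * restr X g" by (auto simp: restr_def)
    then show ?case using mult assms(5)[of "restr X f" "restr X g"] by (simp add: coordinate_ring_eq times_fun_def)
  qed (use assms in auto)
  then show ?thesis using assms(1) by (auto simp: coordinate_ring_eq)
qed

lemma coordinate_ring_outside: "f \<in> coordinate_ring C X \<Longrightarrow> p \<notin> X \<Longrightarrow> f p = 0"
  by (auto simp: coordinate_ring_def)

lemma coordinate_ring_sum:
  "(\<And>i. i \<in> I \<Longrightarrow> f i \<in> coordinate_ring C X) \<Longrightarrow> (\<Sum>i\<in>I. f i) \<in> coordinate_ring C X"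
  by (induction I rule: infinite_finite_induct) (auto simp: coordinate_ring_0 coordinate_ring_add)

text \<open>A member of the ring already vanishes outside \<open>X\<close>, so it can be pulled out
  of \<open>restr\<close>. The outer \<open>restr\<close> turns the empty product, the constant
  \<open>1\<close>, into the unit of the ring.\<close>

lemma restr_prod_insert:
  assumes "finite I" "i \<notin> I" "f i \<in> coordinate_ring C X"
  shows "restr X (\<Prod>t\<in>insert i I. f t) = f i * restr X (\<Prod>t\<in>I. f t)"
  using assms coordinate_ring_outside[OF assms(3)] by (auto simp: restr_def)

lemma coordinate_ring_prod:
  assumes "\<And>i. i \<in> I \<Longrightarrow> f i \<in> coordinate_ring C X"
  shows "restr X (\<Prod>i\<in>I. f i) \<in> coordinate_ring C X"
  using assms
proof (induction I rule: infinite_finite_induct)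
  case (insert i I)
  have "f i * restr X (\<Prod>t\<in>I. f t) \<in> coordinate_ring C X"
    using insert by (simp add: coordinate_ring_mult)
  moreover have "restr X (\<Prod>t\<in>insert i I. f t) = f i * restr X (\<Prod>t\<in>I. f t)"
    by (rule restr_prod_insert[of I i f C X]) (use insert in auto)
  ultimately show ?case by (simp only:)
qed (auto simp: coordinate_ring_const one_fun_def)

section \<open>Leibniz calculus for derivations\<close>

lemma VecI:
  assumes "\<And>f. f \<in> coordinate_ring C X \<Longrightarrow> D f \<in> coordinate_ring C X"
    and "\<And>f g. f \<in> coordinate_ring C X \<Longrightarrow> g \<in> coordinate_ring C X \<Longrightarrow> D (f + g) = D f + D g"
    and "\<And>c f. f \<in> coordinate_ring C X \<Longrightarrow> D (fun_scale c f) = fun_scale c (D f)"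
    and "\<And>f g. f \<in> coordinate_ring C X \<Longrightarrow> g \<in> coordinate_ring C X \<Longrightarrow> D (f * g) = D f * g + f * D g"
    and "\<And>f. f \<notin> coordinate_ring C X \<Longrightarrow> D f = 0"
  shows "D \<in> Vec C X"
  using assms by (simp add: Vec_def derivations_def)

text \<open>The first clause covers every \<open>f\<close>: outside the ring the value is
  \<open>0\<close>, which belongs to the ring.\<close>

lemma VecD:
  assumes "D \<in> Vec C X"
  shows "D f \<in> coordinate_ring C X"
    and "f \<in> coordinate_ring C X \<Longrightarrow> g \<in> coordinate_ring C X \<Longrightarrow> D (f + g) = D f + D g"
    and "f \<in> coordinate_ring C X \<Longrightarrow> D (fun_scale c f) = fun_scale c (D f)"
    and "f \<in> coordinate_ring C X \<Longrightarrow> g \<in> coordinate_ring C X \<Longrightarrow> D (f * g) = D f * g + f * D g"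
    and "f \<notin> coordinate_ring C X \<Longrightarrow> D f = 0"
  using assms coordinate_ring_0[of C X] by (cases "f \<in> coordinate_ring C X"; auto simp: Vec_def derivations_def)+

lemma fun_scale_restr_1: "fun_scale c (restr X (\<lambda>_. 1)) = restr X (\<lambda>_. c :: 'k::comm_ring_1)"
  by (auto simp: fun_scale_def restr_def)

text \<open>The unit \<open>e\<close> is idempotent, so the Leibniz rule gives
  \<open>D e = D e + D e\<close>.\<close>

lemma Vec_const:
  assumes D: "D \<in> Vec C X"
  shows "D (restr X (\<lambda>_. c)) = 0"
proof -
  let ?e = "restr X (\<lambda>_. 1)"
  have e: "?e \<in> coordinate_ring C X" by (rule coordinate_ring_const)
  have ee: "g * ?e = g" if "g \<in> coordinate_ring C X" for g
    using coordinate_ring_outside[OF that] by (auto simp: restr_def fun_eq_iff)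
  have "D (?e * ?e) = D ?e * ?e + ?e * D ?e" by (rule VecD(4)[OF D e e])
  then have "D ?e = D ?e + D ?e"
    using ee[OF e] ee[OF VecD(1)[OF D, of ?e]] by (simp add: mult.commute)
  then have "D ?e = 0" by simp
  then have "D (fun_scale c ?e) = 0" by (simp add: VecD(3)[OF D e]) (simp add: fun_scale_def fun_eq_iff)
  then show ?thesis by (simp add: fun_scale_restr_1)
qed

text \<open>The coordinate functions and the constants generate the ring, and derivations kill
  constants.\<close>

lemma Vec_eqI:
  assumes D: "D \<in> Vec C X" and E: "E \<in> Vec C X"
    and eq: "\<And>f. f \<in> C \<Longrightarrow> D (restr X f) = E (restr X f)"
  shows "D = E"
proof
  fix f
  show "D f = E f"
  proof (cases "f \<in> coordinate_ring C X")
    case True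
    then show ?thesis
      by (rule coordinate_ring_induct[where P = "\<lambda>f. D f = E f"])
        (simp_all add: Vec_const[OF D] Vec_const[OF E] eq VecD[OF D] VecD[OF E])
  qed (simp add: VecD[OF D] VecD[OF E])
qed

lemma Vec_sum_apply:
  assumes D: "D \<in> Vec C X" and "\<And>i. i \<in> I \<Longrightarrow> f i \<in> coordinate_ring C X"
  shows "D (\<Sum>i\<in>I. f i) = (\<Sum>i\<in>I. D (f i))"
  using assms(2)
  by (induction I rule: infinite_finite_induct) (simp_all add: Vec_0_diff[OF D] VecD(2)[OF D] coordinate_ring_sum)

lemma Vec_prod:
  assumes D: "D \<in> Vec C X" and "finite I" and "\<And>i. i \<in> I \<Longrightarrow> f i \<in> coordinate_ring C X"
  shows "D (restr X (\<Prod>i\<in>I. f i)) = (\<Sum>i\<in>I. D (f i) * restr X (\<Prod>j\<in>I - {i}. f j))"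
  using assms(2,3)
proof (induction I)
  case empty
  then show ?case using Vec_const[OF D, of 1] by (simp add: one_fun_def)
next
  case (insert i I)
  have fi: "f i \<in> coordinate_ring C X" using insert by simp
  have P: "restr X (\<Prod>j\<in>I. f j) \<in> coordinate_ring C X" using insert by (intro coordinate_ring_prod) simp
  have "D (restr X (\<Prod>j\<in>insert i I. f j)) = D (f i) * restr X (\<Prod>j\<in>I. f j) + f i * D (restr X (\<Prod>j\<in>I. f j))"
    by (simp only: restr_prod_insert[of I i f C X, OF insert(1,2) fi] VecD(4)[OF D fi P])
  also have "f i * D (restr X (\<Prod>j\<in>I. f j)) = (\<Sum>k\<in>I. D (f k) * (f i * restr X (\<Prod>j\<in>I - {k}. f j)))"
  proof -
    have "D (restr X (\<Prod>j\<in>I. f j)) = (\<Sum>k\<in>I. D (f k) * restr X (\<Prod>j\<in>I - {k}. f j))"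
      by (rule insert.IH) (use insert in auto)
    then show ?thesis by (simp only: sum_distrib_left mult.left_commute)
  qed
  also have "\<dots> = (\<Sum>k\<in>I. D (f k) * restr X (\<Prod>j\<in>insert i I - {k}. f j))"
  proof (rule sum.cong[OF refl])
    fix k assume k: "k \<in> I"
    then have "insert i I - {k} = insert i (I - {k})" using insert(2) by auto
    moreover have "restr X (\<Prod>j\<in>insert i (I - {k}). f j) = f i * restr X (\<Prod>j\<in>I - {k}. f j)"
      using insert(1,2) by (intro restr_prod_insert[of _ i f C X, OF _ _ fi]) auto
    ultimately show "D (f k) * (f i * restr X (\<Prod>j\<in>I - {k}. f j)) = D (f k) * restr X (\<Prod>j\<in>insert i I - {k}. f j)"
      by simp
  qed
  also have "I = insert i I - {i}" using insert by auto
  finally show ?case using insert by (simp add: insert_Diff_if)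
qed

lemma Vec_sum:
  fixes D :: "'i \<Rightarrow> ('p \<Rightarrow> 'k::field) \<Rightarrow> 'p \<Rightarrow> 'k"
  assumes "\<And>i. i \<in> I \<Longrightarrow> D i \<in> Vec C X"
  shows "(\<Sum>i\<in>I. D i) \<in> Vec C X"
proof -
  interpret lie_algebra op_scale "Vec C X" commutator by (rule lie_algebra_Vec)
  show ?thesis using assms by (rule subspace_sum[OF subspace_carrier])
qed

lemma commutator_sum_right:
  fixes D :: "('p \<Rightarrow> 'k::field) \<Rightarrow> 'p \<Rightarrow> 'k"
  assumes "D \<in> Vec C X" "\<And>i. i \<in> I \<Longrightarrow> E i \<in> Vec C X"
  shows "commutator D (\<Sum>i\<in>I. E i) = (\<Sum>i\<in>I. commutator D (E i))"
proof -
  interpret lie_algebra op_scale "Vec C X" commutator by (rule lie_algebra_Vec)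
  have "commutator D 0 = 0"
    using bracket_add_right[OF assms(1), of 0 0] subspace_0[OF subspace_carrier] by simp
  then show ?thesis
    using assms(2)
    by (induction I rule: infinite_finite_induct) (simp_all add: bracket_add_right[OF assms(1)] Vec_sum)
qed

section \<open>Vector fields as a module over the coordinate ring\<close>

definition vf_mult :: "('p \<Rightarrow> 'k) \<Rightarrow> (('p \<Rightarrow> 'k) \<Rightarrow> 'p \<Rightarrow> 'k) \<Rightarrow> ('p \<Rightarrow> 'k) \<Rightarrow> 'p \<Rightarrow> 'k::comm_ring_1" where
  "vf_mult g D = (\<lambda>f. g * D f)"

lemma vf_mult_Vec:
  assumes D: "D \<in> Vec C X" and g: "g \<in> coordinate_ring C X"
  shows "vf_mult g D \<in> Vec C X"
proof (rule VecI)
  fix c f assume f: "f \<in> coordinate_ring C X"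
  show "vf_mult g D (fun_scale c f) = fun_scale c (vf_mult g D f)"
    by (simp add: vf_mult_def VecD(3)[OF D f]) (simp add: fun_scale_def fun_eq_iff)
qed (simp_all add: vf_mult_def VecD[OF D] g coordinate_ring_mult algebra_simps)

lemma vf_mult_const:
  assumes D: "D \<in> Vec C X"
  shows "vf_mult (restr X (\<lambda>_. c)) D = op_scale c D"
  using coordinate_ring_outside[OF VecD(1)[OF D]]
  by (auto simp: vf_mult_def op_scale_def fun_scale_def restr_def fun_eq_iff)

text \<open>In general \<open>[D, g E] = D(g) E + g [D, E]\<close>. With commuting fields, a
  coefficient in the image of \<open>D\<close> thus turns a multiple of \<open>E\<close> into a
  single bracket.\<close>

lemma commutator_vf_mult:
  assumes D: "D \<in> Vec C X" and E: "E \<in> Vec C X" and g: "g \<in> coordinate_ring C X"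
    and comm: "commutator D E = 0"
  shows "commutator D (vf_mult g E) = vf_mult (D g) E"
proof
  fix f
  have "D (E f) = E (D f)" using comm by (simp add: commutator_def fun_eq_iff)
  moreover have "D (g * E f) = D g * E f + g * D (E f)"
    using VecD(4)[OF D g VecD(1)[OF E]] .
  ultimately show "commutator D (vf_mult g E) f = vf_mult (D g) E f"
    by (simp add: commutator_def vf_mult_def)
qed

text \<open>Values prescribed on coordinates must respect the relations that hold on
  \<open>X\<close>. Differentiating along maps of \<open>X\<close> into itself ensures this without
  an explicit description of the ideal of \<open>X\<close>.\<close>

lemma derivation_of_flow:
  fixes \<gamma> :: "'k::field_char_0 \<Rightarrow> 'p \<Rightarrow> 'p"
  assumes stay: "\<And>t p. p \<in> X \<Longrightarrow> \<gamma> t p \<in> X" and start: "\<And>p. p \<in> X \<Longrightarrow> \<gamma> 0 p = p"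
    and u: "\<And>f. f \<in> C \<Longrightarrow> u f \<in> coordinate_ring C X"
    and flow: "\<And>f t p. f \<in> C \<Longrightarrow> p \<in> X \<Longrightarrow> f (\<gamma> t p) = f p + t * u f p"
  shows "\<exists>D\<in>Vec C X. \<forall>f\<in>C. D (restr X f) = u f"
proof -
  let ?R = "coordinate_ring C X"
  \<comment> \<open>\<open>D f\<close> is the coefficient of \<open>t\<close> in \<open>f (\<gamma> t p)\<close>, which is a polynomial in \<open>t\<close>.\<close>
  define Q where "Q f P \<longleftrightarrow> (\<forall>p\<in>X. \<forall>t. poly (P p) t = f (\<gamma> t p))" for f and P :: "'p \<Rightarrow> 'k poly"
  define d where "d P = restr X (\<lambda>p. coeff (P p) 1)" for P :: "'p \<Rightarrow> 'k poly"
  \<comment> \<open>A field of characteristic zero is infinite, so a polynomial is determined by its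
    values.\<close>
  have uniq: "d P = d P'" if "Q f P" "Q f P'" for f P P'
  proof -
    have "P p = P' p" if "p \<in> X" for p
    proof -
      have "poly (P p) = poly (P' p)" using that \<open>Q f P\<close> \<open>Q f P'\<close> by (auto simp: Q_def)
      then show ?thesis by (simp only: poly_eq_poly_eq_iff)
    qed
    then show ?thesis by (auto simp: d_def restr_def)
  qed
  \<comment> \<open>The flow starts at the identity. This identifies the factors \<open>g\<close>
    and \<open>f\<close> in the Leibniz rule \<open>dmult\<close>.\<close>
  have coeff0: "coeff (P p) 0 = f p" if "Q f P" "p \<in> X" for f P p
    using that start[OF that(2)] by (metis Q_def poly_0_coeff_0)
  have Qadd: "Q (f + g) (P + P')" if "Q f P" "Q g P'" for f g P P'
    using that by (auto simp: Q_def)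
  have Qmult: "Q (f * g) (P * P')" if "Q f P" "Q g P'" for f g P P'
    using that by (auto simp: Q_def)
  have dadd: "d (P + P') = d P + d P'" for P P'
    by (auto simp: d_def restr_def)
  have dmult: "d (P * P') = d P * g + f * d P'" if "Q f P" "Q g P'" for f g P P'
    using coeff0[OF that(1)] coeff0[OF that(2)]
    by (auto simp: d_def restr_def fun_eq_iff coeff_mult)
  have Qcoord: "Q (restr X f) (\<lambda>p. [:f p, u f p:])" "d (\<lambda>p. [:f p, u f p:]) = u f" if "f \<in> C" for f
    using flow[OF that] stay coordinate_ring_outside[OF u[OF that]] by (auto simp: Q_def d_def restr_def fun_eq_iff)
  have Qconst: "Q (restr X (\<lambda>_. c)) (\<lambda>p. [:c:])" "d (\<lambda>p. [:c:]) = 0" for c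
    using stay by (auto simp: Q_def d_def restr_def fun_eq_iff)
  have ex: "\<exists>P. Q f P \<and> d P \<in> ?R" if "f \<in> ?R" for f
    using that
  proof (induction rule: coordinate_ring_induct)
    case (const c)
    then show ?case using Qconst[of c] coordinate_ring_0 by metis
  next
    case (coord f)
    then show ?case using Qcoord[of f] u by metis
  next
    case (add f g)
    then show ?case using Qadd dadd coordinate_ring_add by metis
  next
    case (mult f g)
    then obtain P P' where "Q f P" "Q g P'" "d P \<in> ?R" "d P' \<in> ?R" by blast
    then show ?case using mult(1,2) Qmult[of f P g P'] dmult[of f P g P']
      by (metis coordinate_ring_add coordinate_ring_mult)
  qed
  define D where "D f = (if f \<in> ?R then d (SOME P. Q f P) else 0)" for f
  have D: "D f = d P" if "Q f P" "f \<in> ?R" for f P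
    using that uniq[OF someI[of "Q f" P, OF that(1)] that(1)] by (simp add: D_def)
  have "D \<in> Vec C X"
  proof (rule VecI)
    fix f assume f: "f \<in> ?R"
    then obtain P where P: "Q f P" "d P \<in> ?R" using ex by blast
    then show "D f \<in> ?R" using D f by simp
    fix c
    have "fun_scale c f = restr X (\<lambda>_. c) * f"
      using coordinate_ring_outside[OF f] by (auto simp: fun_scale_def restr_def fun_eq_iff)
    then have "D (fun_scale c f) = d (\<lambda>p. [:c:]) * f + restr X (\<lambda>_. c) * d P"
      using D[OF Qmult[OF Qconst(1) P(1)]] dmult[OF Qconst(1) P(1)] f
      by (simp add: coordinate_ring_mult coordinate_ring_const)
    also have "\<dots> = fun_scale c (D f)"
      using D[OF P(1) f] Qconst(2)[of c] coordinate_ring_outside[OF P(2)]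
      by (auto simp: fun_scale_def restr_def fun_eq_iff)
    finally show "D (fun_scale c f) = fun_scale c (D f)" .
    fix g assume g: "g \<in> ?R"
    then obtain P' where P': "Q g P'" "d P' \<in> ?R" using ex by blast
    show "D (f + g) = D f + D g"
      using D[OF Qadd[OF P(1) P'(1)]] D[OF P(1) f] D[OF P'(1) g] dadd f g by (simp add: coordinate_ring_add)
    show "D (f * g) = D f * g + f * D g"
      using D[OF Qmult[OF P(1) P'(1)]] D[OF P(1) f] D[OF P'(1) g] dmult[OF P(1) P'(1)] f g
      by (simp add: coordinate_ring_mult)
  qed (simp add: D_def)
  moreover have "D (restr X f) = u f" if "f \<in> C" for f
    using D[OF Qcoord(1)[OF that] coordinate_ring_coord[OF that]] Qcoord(2)[OF that] by simp
  ultimately show ?thesis by blast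
qed

section \<open>Row and column fields\<close>

abbreviation SL_ring :: "nat \<Rightarrow> ('k::comm_ring_1 mat \<Rightarrow> 'k) set" where
  "SL_ring n \<equiv> coordinate_ring (matrix_entries n) (SL n)"

definition entry :: "nat \<Rightarrow> nat \<Rightarrow> nat \<Rightarrow> 'k::comm_ring_1 mat \<Rightarrow> 'k" where
  "entry n a b = restr (SL n) (\<lambda>A. A $$ (a, b))"

lemma entry_apply: "entry n a b A = (if A \<in> SL n then A $$ (a, b) else 0)"
  by (simp add: entry_def restr_def)

lemma SL_carrier: "A \<in> SL n \<Longrightarrow> A \<in> carrier_mat n n"
  by (simp add: SL_def)

lemma entry_mem: "a < n \<Longrightarrow> b < n \<Longrightarrow> entry n a b \<in> SL_ring n"
  unfolding entry_def by (rule coordinate_ring_coord) (auto simp: matrix_entries_def)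

lemma Vec_SL_eqI:
  assumes "D \<in> Vec_SL n" "E \<in> Vec_SL n"
    and "\<And>a b. a < n \<Longrightarrow> b < n \<Longrightarrow> D (entry n a b) = E (entry n a b)"
  shows "D = E"
  using assms unfolding Vec_SL_def
  by (elim Vec_eqI) (auto simp: matrix_entries_def entry_def)

lemma Vec_SL_of_flow:
  fixes \<gamma> :: "'k::field_char_0 \<Rightarrow> 'k mat \<Rightarrow> 'k mat"
  assumes stay: "\<And>t A. A \<in> SL n \<Longrightarrow> \<gamma> t A \<in> SL n"
    and v: "\<And>a b. a < n \<Longrightarrow> b < n \<Longrightarrow> v a b \<in> SL_ring n"
    and flow: "\<And>a b t A. a < n \<Longrightarrow> b < n \<Longrightarrow> A \<in> SL n \<Longrightarrow> \<gamma> t A $$ (a, b) = A $$ (a, b) + t * v a b A"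
  shows "\<exists>D\<in>Vec_SL n. \<forall>a<n. \<forall>b<n. D (entry n a b) = v a b"
proof -
  \<comment> \<open>\<open>derivation_of_flow\<close> expects speeds indexed by functions rather
    than by index pairs. As entries move affinely in \<open>t\<close>, the increment up to time
    \<open>1\<close> is the speed.\<close>
  define u where "u f = restr (SL n) (\<lambda>A. f (\<gamma> 1 A) - f A)" for f :: "'k mat \<Rightarrow> 'k"
  have u: "u (\<lambda>A. A $$ (a, b)) = v a b" if "a < n" "b < n" for a b
    using flow[OF that] coordinate_ring_outside[OF v[OF that]] by (auto simp: u_def restr_def fun_eq_iff)
  have "\<exists>D\<in>Vec (matrix_entries n) (SL n). \<forall>f\<in>matrix_entries n. D (restr (SL n) f) = u f"
  proof (rule derivation_of_flow[of "SL n" \<gamma>])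
    show "\<gamma> 0 A = A" if A: "A \<in> SL n" for A
      using flow[OF _ _ A, of _ _ 0] A stay[OF A, of 0] by (intro eq_matI) (auto simp: SL_def)
    show "u f \<in> SL_ring n" if "f \<in> matrix_entries n" for f
      using that v u by (auto simp: matrix_entries_def)
    show "f (\<gamma> t A) = f A + t * u f A" if "f \<in> matrix_entries n" "A \<in> SL n" for f t A
      using that u flow by (auto simp: matrix_entries_def)
    show "\<gamma> t A \<in> SL n" if "A \<in> SL n" for t A
      using that by (rule stay)
  qed
  then obtain D where D: "D \<in> Vec_SL n" "\<And>f. f \<in> matrix_entries n \<Longrightarrow> D (restr (SL n) f) = u f"
    by (auto simp: Vec_SL_def)
  have "D (entry n a b) = v a b" if "a < n" "b < n" for a b
    using D(2)[of "\<lambda>A. A $$ (a, b)"] u[OF that] that by (auto simp: entry_def matrix_entries_def)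
  with D(1) show ?thesis by blast
qed

text \<open>The derivative at \<open>t = 0\<close> along adding \<open>t\<close> times row (column) \<open>i\<close> to row (column) \<open>j\<close>.\<close>

definition row_field :: "nat \<Rightarrow> nat \<Rightarrow> nat \<Rightarrow> ('k::field_char_0 mat \<Rightarrow> 'k) \<Rightarrow> 'k mat \<Rightarrow> 'k" where
  "row_field n i j = (SOME D. D \<in> Vec_SL n \<and>
    (\<forall>a<n. \<forall>b<n. D (entry n a b) = (if a = j then entry n i b else 0)))"

definition col_field :: "nat \<Rightarrow> nat \<Rightarrow> nat \<Rightarrow> ('k::field_char_0 mat \<Rightarrow> 'k) \<Rightarrow> 'k mat \<Rightarrow> 'k" where
  "col_field n i j = (SOME D. D \<in> Vec_SL n \<and>
    (\<forall>a<n. \<forall>b<n. D (entry n a b) = (if b = j then entry n a i else 0)))"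

lemma row_field:
  assumes "i < n" "j < n" "i \<noteq> j"
  shows row_field_Vec: "(row_field n i j :: ('k::field_char_0 mat \<Rightarrow> 'k) \<Rightarrow> _) \<in> Vec_SL n"
    and row_field_entry: "a < n \<Longrightarrow> b < n \<Longrightarrow>
      row_field n i j (entry n a b) = (if a = j then entry n i b else (0 :: 'k mat \<Rightarrow> 'k))"
proof -
  have "\<exists>D\<in>Vec_SL n. \<forall>a<n. \<forall>b<n. D (entry n a b) = (if a = j then entry n i b else (0 :: 'k mat \<Rightarrow> 'k))"
  \<comment> \<open>Adding a multiple of one row to another preserves the determinant and moves
    every entry affinely in \<open>t\<close>.\<close>
  proof (rule Vec_SL_of_flow[of n "\<lambda>t. addrow t j i"])
    show "addrow t j i A \<in> SL n" if "A \<in> SL n" for t :: 'k and A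
      using that assms det_addrow[of i n j A t] by (auto simp: SL_def)
  qed (use assms in \<open>auto simp: entry_mem coordinate_ring_0 entry_apply dest!: SL_carrier\<close>)
  then have "\<exists>D. D \<in> Vec_SL n \<and> (\<forall>a<n. \<forall>b<n. D (entry n a b) = (if a = j then entry n i b else (0 :: 'k mat \<Rightarrow> 'k)))"
    by blast
  from someI_ex[OF this]
  show "(row_field n i j :: ('k mat \<Rightarrow> 'k) \<Rightarrow> _) \<in> Vec_SL n"
    and "a < n \<Longrightarrow> b < n \<Longrightarrow> row_field n i j (entry n a b) = (if a = j then entry n i b else (0 :: 'k mat \<Rightarrow> 'k))"
    unfolding row_field_def[symmetric] by blast+
qed

lemma col_field:
  assumes "i < n" "j < n" "i \<noteq> j"
  shows col_field_Vec: "(col_field n i j :: ('k::field_char_0 mat \<Rightarrow> 'k) \<Rightarrow> _) \<in> Vec_SL n"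
    and col_field_entry: "a < n \<Longrightarrow> b < n \<Longrightarrow>
      col_field n i j (entry n a b) = (if b = j then entry n a i else (0 :: 'k mat \<Rightarrow> 'k))"
proof -
  have "\<exists>D\<in>Vec_SL n. \<forall>a<n. \<forall>b<n. D (entry n a b) = (if b = j then entry n a i else (0 :: 'k mat \<Rightarrow> 'k))"
  proof (rule Vec_SL_of_flow[of n "\<lambda>t. addcol t j i"])
    show "addcol t j i A \<in> SL n" if "A \<in> SL n" for t :: 'k and A
      using that assms det_addcol[of i n j A t] by (auto simp: SL_def)
  qed (use assms in \<open>auto simp: entry_mem coordinate_ring_0 entry_apply dest!: SL_carrier\<close>)
  then have "\<exists>D. D \<in> Vec_SL n \<and> (\<forall>a<n. \<forall>b<n. D (entry n a b) = (if b = j then entry n a i else (0 :: 'k mat \<Rightarrow> 'k)))"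
    by blast
  from someI_ex[OF this]
  show "(col_field n i j :: ('k mat \<Rightarrow> 'k) \<Rightarrow> _) \<in> Vec_SL n"
    and "a < n \<Longrightarrow> b < n \<Longrightarrow> col_field n i j (entry n a b) = (if b = j then entry n a i else (0 :: 'k mat \<Rightarrow> 'k))"
    unfolding col_field_def[symmetric] by blast+
qed

definition off_diagonal :: "nat \<Rightarrow> (nat \<times> nat) set" where
  "off_diagonal n = {(i, j). i < n \<and> j < n \<and> i \<noteq> j}"

lemma finite_off_diagonal: "finite (off_diagonal n)"
  by (rule finite_subset[of _ "{..<n} \<times> {..<n}"]) (auto simp: off_diagonal_def)

lemma card_off_diagonal: "card (off_diagonal n) = n * n - n"
proof -
  have "off_diagonal n = {..<n} \<times> {..<n} - (\<lambda>i. (i, i)) ` {..<n}"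
    by (auto simp: off_diagonal_def)
  moreover have "card ((\<lambda>i. (i, i)) ` {..<n}) = n" by (simp add: card_image inj_on_def)
  ultimately show ?thesis by (subst \<open>off_diagonal n = _\<close>, subst card_Diff_subset) auto
qed

section \<open>Regular functions modulo the images of the row fields\<close>

text \<open>Each pair \<open>(i, j)\<close> contributes the image of one function only, so the
  number of terms is \<open>n * n - n\<close> for every \<open>f\<close>; this number becomes the
  bracket count.\<close>

definition row_span :: "nat \<Rightarrow> ('k::field_char_0 mat \<Rightarrow> 'k) set" where
  "row_span n = {f. \<exists>c g. (\<forall>q. g q \<in> SL_ring n) \<and>
     f = restr (SL n) (\<lambda>_. c) + (\<Sum>(i, j)\<in>off_diagonal n. row_field n i j (g (i, j)))}"

interpretation fun_vs: vector_space "fun_scale :: 'k::field \<Rightarrow> ('p \<Rightarrow> 'k) \<Rightarrow> 'p \<Rightarrow> 'k"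
  by unfold_locales (auto simp: fun_scale_def fun_eq_iff algebra_simps)

lemma Vec_SL_zero:
  "D \<in> Vec_SL n \<Longrightarrow> D 0 = 0"
  unfolding Vec_SL_def by (rule Vec_0_diff(1))

text \<open>The row fields are linear, so two representations are added pair by pair and no new
  terms arise.\<close>

lemma row_span_subspace: "module.subspace fun_scale (row_span n :: ('k::field_char_0 mat \<Rightarrow> 'k) set)"
  unfolding fun_vs.subspace_def
proof (intro conjI ballI allI)
  let ?off = "off_diagonal n"
  have V: "(row_field n i j :: ('k mat \<Rightarrow> 'k) \<Rightarrow> _) \<in> Vec (matrix_entries n) (SL n)" if "(i, j) \<in> ?off" for i j
    using that row_field_Vec[of i n j] by (auto simp: off_diagonal_def Vec_SL_def)
  show "0 \<in> (row_span n :: ('k mat \<Rightarrow> 'k) set)"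
  proof -
    have "(\<Sum>(i, j)\<in>?off. row_field n i j (0 :: 'k mat \<Rightarrow> 'k)) = 0"
      by (rule sum.neutral) (use Vec_0_diff(1)[OF V] in auto)
    moreover have "restr (SL n) (\<lambda>_. 0) = (0 :: 'k mat \<Rightarrow> 'k)" by (auto simp: restr_def)
    ultimately have "(0 :: 'k mat \<Rightarrow> 'k) = restr (SL n) (\<lambda>_. 0) + (\<Sum>(i, j)\<in>?off. row_field n i j 0)"
      by simp
    then show ?thesis
      unfolding row_span_def using coordinate_ring_0
      by (intro CollectI exI[of _ 0] exI[of _ "\<lambda>_. 0"]) auto
  qed
  fix f f' :: "'k mat \<Rightarrow> 'k"
  assume "f \<in> row_span n"
  then obtain c g where g: "\<And>q. g q \<in> SL_ring n"
    and f: "f = restr (SL n) (\<lambda>_. c) + (\<Sum>(i, j)\<in>?off. row_field n i j (g (i, j)))"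
    by (auto simp: row_span_def)
  show "fun_scale a f \<in> row_span n" for a
  proof -
    have "(\<Sum>(i, j)\<in>?off. row_field n i j (fun_scale a (g (i, j)))) =
        fun_scale a (\<Sum>(i, j)\<in>?off. row_field n i j (g (i, j)))"
      unfolding fun_vs.scale_sum_right
      by (rule sum.cong[OF refl]) (use VecD(3)[OF V g] in auto)
    moreover have "fun_scale a (restr (SL n) (\<lambda>_. c)) = (restr (SL n) (\<lambda>_. a * c) :: 'k mat \<Rightarrow> 'k)"
      by (auto simp: fun_scale_def restr_def)
    ultimately have "fun_scale a f = restr (SL n) (\<lambda>_. a * c) +
        (\<Sum>(i, j)\<in>?off. row_field n i j (fun_scale a (g (i, j))))"
      unfolding f by (simp only: fun_vs.scale_right_distrib)
    then show ?thesis
      unfolding row_span_def using coordinate_ring_scale[OF g]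
      by (intro CollectI exI[of _ "a * c"] exI[of _ "\<lambda>q. fun_scale a (g q)"]) blast
  qed
  assume "f' \<in> row_span n"
  then obtain c' g' where g': "\<And>q. g' q \<in> SL_ring n"
    and f': "f' = restr (SL n) (\<lambda>_. c') + (\<Sum>(i, j)\<in>?off. row_field n i j (g' (i, j)))"
    by (auto simp: row_span_def)
  have "(\<Sum>(i, j)\<in>?off. row_field n i j (g (i, j) + g' (i, j))) =
      (\<Sum>(i, j)\<in>?off. row_field n i j (g (i, j))) + (\<Sum>(i, j)\<in>?off. row_field n i j (g' (i, j)))"
    unfolding sum.distrib[symmetric]
    by (rule sum.cong[OF refl]) (use VecD(2)[OF V g g'] in auto)
  moreover have "restr (SL n) (\<lambda>_. c + c') = (restr (SL n) (\<lambda>_. c) + restr (SL n) (\<lambda>_. c') :: 'k mat \<Rightarrow> 'k)"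
    by (auto simp: restr_def)
  ultimately have "f + f' = restr (SL n) (\<lambda>_. c + c') +
      (\<Sum>(i, j)\<in>?off. row_field n i j (g (i, j) + g' (i, j)))"
    unfolding f f' by (simp only: ac_simps)
  then show "f + f' \<in> row_span n"
    unfolding row_span_def using coordinate_ring_add[OF g g']
    by (intro CollectI exI[of _ "c + c'"] exI[of _ "\<lambda>q. g q + g' q"]) blast
qed

lemma row_span_const: "restr (SL n) (\<lambda>_. c) \<in> (row_span n :: ('k::field_char_0 mat \<Rightarrow> 'k) set)"
proof -
  have "(\<Sum>(i, j)\<in>off_diagonal n. row_field n i j (0 :: 'k mat \<Rightarrow> 'k)) = 0"
    by (rule sum.neutral) (auto simp: off_diagonal_def Vec_SL_zero[OF row_field_Vec])
  then show ?thesis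
    unfolding row_span_def using coordinate_ring_0
    by (intro CollectI exI[of _ c] exI[of _ "\<lambda>_. 0"]) auto
qed

lemma row_span_row_field:
  fixes f :: "'k::field_char_0 mat \<Rightarrow> 'k"
  assumes ij: "i < n" "j < n" "i \<noteq> j" and f: "f \<in> SL_ring n"
  shows "row_field n i j f \<in> row_span n"
proof -
  define g where "g q = (if q = (i, j) then f else 0)" for q
  have "(\<Sum>(k, l)\<in>off_diagonal n. row_field n k l (g (k, l))) =
      (\<Sum>q\<in>off_diagonal n. if q = (i, j) then row_field n i j f else 0)"
    by (rule sum.cong[OF refl]) (auto simp: g_def off_diagonal_def Vec_SL_zero[OF row_field_Vec])
  also have "\<dots> = row_field n i j f"
    using ij finite_off_diagonal[of n] by (simp add: off_diagonal_def)
  finally have "row_field n i j f =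
      restr (SL n) (\<lambda>_. 0) + (\<Sum>(k, l)\<in>off_diagonal n. row_field n k l (g (k, l)))"
    by (auto simp: restr_def)
  moreover have "g q \<in> SL_ring n" for q using f coordinate_ring_0 by (auto simp: g_def)
  ultimately show ?thesis unfolding row_span_def by blast
qed

text \<open>Factors are indexed by an arbitrary set of positions, with words \<open>r\<close> and
  \<open>c\<close> for rows and columns. Dropping factors then just shrinks \<open>I\<close>,
  without renumbering.\<close>

definition entry_monomial :: "nat \<Rightarrow> 'i set \<Rightarrow> ('i \<Rightarrow> nat) \<Rightarrow> ('i \<Rightarrow> nat) \<Rightarrow> 'k::comm_ring_1 mat \<Rightarrow> 'k" where
  "entry_monomial n I r c = restr (SL n) (\<Prod>t\<in>I. entry n (r t) (c t))"

lemma entry_monomial_apply: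
  "entry_monomial n I r c A = (if A \<in> SL n then \<Prod>t\<in>I. A $$ (r t, c t) else 0)"
  by (simp add: entry_monomial_def restr_def prod_fun_apply entry_apply)

lemma entry_monomial_mem:
  "r \<in> I \<rightarrow> {..<n} \<Longrightarrow> c \<in> I \<rightarrow> {..<n} \<Longrightarrow> entry_monomial n I r c \<in> SL_ring n"
  unfolding entry_monomial_def by (rule coordinate_ring_prod) (auto intro!: entry_mem)

text \<open>By the Leibniz rule, \<open>row_field n i j\<close> replaces one row index
  \<open>j\<close> by \<open>i\<close> in all possible ways. This supplies the relation
  \<open>shift\<close>.\<close>

lemma row_field_monomial:
  assumes ij: "i < n" "j < n" "i \<noteq> j" and I: "finite I"
    and r: "r \<in> I \<rightarrow> {..<n}" and c: "c \<in> I \<rightarrow> {..<n}"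
  shows "row_field n i j (entry_monomial n I r c) =
    (\<Sum>t | t \<in> I \<and> r t = j. entry_monomial n I (r(t := i)) c :: 'k::field_char_0 mat \<Rightarrow> 'k)"
proof -
  have "row_field n i j (entry_monomial n I r c) = (\<Sum>t\<in>I. row_field n i j (entry n (r t) (c t)) *
      restr (SL n) (\<Prod>s\<in>I - {t}. entry n (r s) (c s)) :: 'k mat \<Rightarrow> 'k)"
    unfolding entry_monomial_def
    by (rule Vec_prod[OF row_field_Vec[OF ij, unfolded Vec_SL_def] I]) (use r c in \<open>auto intro!: entry_mem\<close>)
  also have "\<dots> = (\<Sum>t\<in>I. if r t = j then entry_monomial n I (r(t := i)) c else 0)"
  proof (rule sum.cong[OF refl])
    fix t assume t: "t \<in> I"
    have rc: "r t < n" "c t < n" using t r c by auto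
    have "entry n i (c t) * restr (SL n) (\<Prod>s\<in>I - {t}. entry n (r s) (c s)) =
        (entry_monomial n I (r(t := i)) c :: 'k mat \<Rightarrow> 'k)"
    proof
      fix A :: "'k mat"
      have "(\<Prod>s\<in>I. A $$ ((r(t := i)) s, c s)) = A $$ (i, c t) * (\<Prod>s\<in>I - {t}. A $$ ((r(t := i)) s, c s))"
        using t I by (subst prod.remove[of _ t]) auto
      also have "(\<Prod>s\<in>I - {t}. A $$ ((r(t := i)) s, c s)) = (\<Prod>s\<in>I - {t}. A $$ (r s, c s))"
        by (rule prod.cong) auto
      finally show "(entry n i (c t) * restr (SL n) (\<Prod>s\<in>I - {t}. entry n (r s) (c s))) A =
          entry_monomial n I (r(t := i)) c A"
        by (simp add: entry_monomial_apply entry_apply restr_def prod_fun_apply)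
    qed
    then show "row_field n i j (entry n (r t) (c t)) * restr (SL n) (\<Prod>s\<in>I - {t}. entry n (r s) (c s)) =
        (if r t = j then entry_monomial n I (r(t := i)) c else (0 :: 'k mat \<Rightarrow> 'k))"
      by (simp only: row_field_entry[OF ij rc]) (simp add: fun_eq_iff)
  qed
  also have "\<dots> = (\<Sum>t | t \<in> I \<and> r t = j. entry_monomial n I (r(t := i)) c)"
    using I by (simp add: sum.If_cases Int_def)
  finally show ?thesis .
qed

text \<open>The factors at \<open>S\<close> antisymmetrise to the determinant of a matrix whose
  columns are columns of \<open>A\<close>, possibly repeated. It equals \<open>A * P\<close> with
  \<open>P\<close> independent of \<open>A\<close>, so on \<open>SL n\<close> the determinant is the
  constant \<open>det P\<close>.\<close>

lemma alternating_monomial: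
  assumes I: "finite I" and S: "S \<subseteq> I" "bij_betw r S {..<n}" and c: "c \<in> I \<rightarrow> {..<n}"
  shows "\<exists>\<kappa>. (\<Sum>\<sigma> | \<sigma> permutes {..<n}. fun_scale (of_int (sign \<sigma>))
      (entry_monomial n I (\<lambda>t. if t \<in> S then \<sigma> (r t) else r t) c)) =
    fun_scale \<kappa> (entry_monomial n (I - S) r c :: 'k::comm_ring_1 mat \<Rightarrow> 'k)"
proof -
  \<comment> \<open>\<open>d j\<close> is the column index at the position of \<open>S\<close> that
    carries row \<open>j\<close>.\<close>
  define d where "d j = c (inv_into S r j)" for j
  have d: "d j < n" if "j < n" for j
    using that S c inv_into_into[of j r S] by (auto simp: d_def bij_betw_def)
  define P where "P = mat n n (\<lambda>(k, j). if k = d j then 1 else (0 :: 'k))"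
  have "(\<Sum>\<sigma> | \<sigma> permutes {..<n}. of_int (sign \<sigma>) *
      (\<Prod>t\<in>I. A $$ (if t \<in> S then \<sigma> (r t) else r t, c t))) = det P * (\<Prod>t\<in>I - S. A $$ (r t, c t))"
    if A: "A \<in> SL n" for A :: "'k mat"
  proof -
    have Ac: "A \<in> carrier_mat n n" "det A = 1" using A by (auto simp: SL_def)
    define A' where "A' = mat n n (\<lambda>(i, j). A $$ (i, d j))"
    have "A' = A * P"
    proof (rule eq_matI)
      fix i j assume "i < dim_row (A * P)" "j < dim_col (A * P)"
      then have ij: "i < n" "j < n" using Ac by (auto simp: P_def)
      have "(A * P) $$ (i, j) = (\<Sum>k = 0..<n. A $$ (i, k) * (if k = d j then 1 else 0))"
        using ij Ac by (simp add: P_def scalar_prod_def)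
      also have "\<dots> = A $$ (i, d j)" using d[OF ij(2)] by (simp add: if_distrib cong: if_cong)
      finally show "A' $$ (i, j) = (A * P) $$ (i, j)" using ij by (simp add: A'_def)
    qed (use Ac in \<open>auto simp: A'_def P_def\<close>)
    then have detA': "det A' = det P"
      using det_mult[OF Ac(1), of P] Ac by (simp add: P_def)
    have split: "(\<Prod>t\<in>I. A $$ (if t \<in> S then \<sigma> (r t) else r t, c t)) =
        (\<Prod>j<n. A' $$ (\<sigma> j, j)) * (\<Prod>t\<in>I - S. A $$ (r t, c t))" if \<sigma>: "\<sigma> permutes {..<n}" for \<sigma>
    proof -
      have "(\<Prod>j<n. A' $$ (\<sigma> j, j)) = (\<Prod>t\<in>S. A' $$ (\<sigma> (r t), r t))"
        by (rule prod.reindex_bij_betw[OF S(2), symmetric])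
      also have "\<dots> = (\<Prod>t\<in>S. A $$ (if t \<in> S then \<sigma> (r t) else r t, c t))"
      proof (rule prod.cong[OF refl])
        fix t assume t: "t \<in> S"
        then have rt: "r t < n" using S(2) by (auto simp: bij_betw_def)
        then have "\<sigma> (r t) < n" using permutes_in_image[OF \<sigma>, of "r t"] by simp
        moreover have "d (r t) = c t" using t S(2) by (simp add: d_def bij_betw_def inv_into_f_f)
        ultimately show "A' $$ (\<sigma> (r t), r t) = A $$ (if t \<in> S then \<sigma> (r t) else r t, c t)"
          using rt t by (simp add: A'_def)
      qed
      finally have "(\<Prod>j<n. A' $$ (\<sigma> j, j)) = (\<Prod>t\<in>S. A $$ (if t \<in> S then \<sigma> (r t) else r t, c t))" .
      moreover have "(\<Prod>t\<in>I - S. A $$ (if t \<in> S then \<sigma> (r t) else r t, c t)) = (\<Prod>t\<in>I - S. A $$ (r t, c t))"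
        by (rule prod.cong) auto
      ultimately show ?thesis
        using prod.subset_diff[OF S(1) I, of "\<lambda>t. A $$ (if t \<in> S then \<sigma> (r t) else r t, c t)"]
        by (simp add: mult.commute)
    qed
    have "(\<Sum>\<sigma> | \<sigma> permutes {..<n}. of_int (sign \<sigma>) *
        (\<Prod>t\<in>I. A $$ (if t \<in> S then \<sigma> (r t) else r t, c t))) =
      (\<Sum>\<sigma> | \<sigma> permutes {..<n}. of_int (sign \<sigma>) * (\<Prod>j<n. A' $$ (\<sigma> j, j))) * (\<Prod>t\<in>I - S. A $$ (r t, c t))"
      unfolding sum_distrib_right by (rule sum.cong[OF refl]) (simp add: split mult.assoc)
    also have "(\<Sum>\<sigma> | \<sigma> permutes {..<n}. of_int (sign \<sigma>) * (\<Prod>j<n. A' $$ (\<sigma> j, j))) = det A'"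
      using det_col[of A' n] by (simp add: A'_def atLeast0LessThan)
    finally show ?thesis by (simp add: detA')
  qed
  then show ?thesis
    by (intro exI[of _ "det P"]) (auto simp: fun_eq_iff sum_fun_apply fun_scale_def entry_monomial_apply)
qed

text \<open>Induction on the set of positions: modulo \<open>row_span\<close>, an antisymmetrised
  monomial loses the positions in \<open>S\<close>, and these exist since
  \<open>n > 0\<close>.\<close>

lemma entry_monomial_row_span:
  assumes "n > 0" and I: "finite I" and r: "r \<in> I \<rightarrow> {..<n}" and c: "c \<in> I \<rightarrow> {..<n}"
  shows "entry_monomial n I r c \<in> (row_span n :: ('k::field_char_0 mat \<Rightarrow> 'k) set)"
  using I r c
proof (induction I arbitrary: r rule: finite_psubset_induct)
  case (psubset I)
  show ?case
  proof (cases "I = {}")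
    case True
    then show ?thesis using row_span_const[of n 1] by (simp add: entry_monomial_def one_fun_def)
  next
    case False
    show ?thesis
    proof (rule alternating_relations_span[where \<phi> = "\<lambda>r. entry_monomial n I r c",
        OF fun_vs.vector_space_axioms row_span_subspace psubset.hyps(1) False _ _ psubset.prems(1)])
      fix r i j assume r: "r \<in> I \<rightarrow> {..<n}" and ij: "i < n" "j < n" "i \<noteq> j"
      show "(\<Sum>t | t \<in> I \<and> r t = j. entry_monomial n I (r(t := i)) c :: 'k mat \<Rightarrow> 'k) \<in> row_span n"
        using row_span_row_field[OF ij entry_monomial_mem[OF r psubset.prems(2)]]
        unfolding row_field_monomial[OF ij psubset.hyps(1) r psubset.prems(2)] .
    next
      fix r S assume r: "r \<in> I \<rightarrow> {..<n}" and S: "S \<subseteq> I" "bij_betw r S {..<n}"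
      have "S \<noteq> {}" using S(2) \<open>n > 0\<close> by (auto simp: bij_betw_def)
      then have "I - S \<subset> I" using S by blast
      then have E: "entry_monomial n (I - S) r c \<in> (row_span n :: ('k mat \<Rightarrow> 'k) set)"
        by (rule psubset.IH) (use r psubset.prems in auto)
      show "(\<Sum>\<sigma> | \<sigma> permutes {..<n}. fun_scale (of_int (sign \<sigma>))
          (entry_monomial n I (\<lambda>t. if t \<in> S then \<sigma> (r t) else r t) c :: 'k mat \<Rightarrow> 'k)) \<in> row_span n"

      proof -
        obtain \<kappa> where "(\<Sum>\<sigma> | \<sigma> permutes {..<n}. fun_scale (of_int (sign \<sigma>))
            (entry_monomial n I (\<lambda>t. if t \<in> S then \<sigma> (r t) else r t) c)) =
          fun_scale \<kappa> (entry_monomial n (I - S) r c :: 'k mat \<Rightarrow> 'k)"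
          using alternating_monomial[OF psubset.hyps(1) S psubset.prems(2)] by blast
        then show ?thesis
          using fun_vs.subspace_scale[OF row_span_subspace E] by simp
      qed
    qed
  qed
qed

text \<open>The monomials span the ring and lie in the subspace \<open>row_span\<close>.\<close>

lemma SL_ring_row_span:
  assumes "n > 0"
  shows "SL_ring n \<subseteq> (row_span n :: ('k::field_char_0 mat \<Rightarrow> 'k) set)"
proof
  define M :: "('k mat \<Rightarrow> 'k) set" where
    "M = {entry_monomial n I r c | I r c. finite (I :: nat set) \<and> r \<in> I \<rightarrow> {..<n} \<and> c \<in> I \<rightarrow> {..<n}}"
  have entry_M: "entry n a b * h \<in> M" if ab: "a < n" "b < n" and "h \<in> M" for a b h
  proof -
    from \<open>h \<in> M\<close> obtain I :: "nat set" and r c where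
      h: "h = entry_monomial n I r c" and I: "finite I" and rc: "r \<in> I \<rightarrow> {..<n}" "c \<in> I \<rightarrow> {..<n}"
      by (auto simp: M_def)
    \<comment> \<open>A new factor needs a fresh position; the infinite type \<open>nat\<close>
      always has one.\<close>
    obtain t where t: "t \<notin> I" using I ex_new_if_finite[of I] by auto
    have "entry n a b * h = entry_monomial n (insert t I) (r(t := a)) (c(t := b))"
    proof
      fix A :: "'k mat"
      have "(\<Prod>s\<in>I. A $$ ((r(t := a)) s, (c(t := b)) s)) = (\<Prod>s\<in>I. A $$ (r s, c s))"
        using t by (intro prod.cong) auto
      then show "(entry n a b * h) A = entry_monomial n (insert t I) (r(t := a)) (c(t := b)) A"
        using I t by (simp add: h entry_monomial_apply entry_apply)
    qed
    moreover have "r(t := a) \<in> insert t I \<rightarrow> {..<n}" "c(t := b) \<in> insert t I \<rightarrow> {..<n}" using ab rc by auto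
    ultimately show ?thesis using I unfolding M_def by blast
  qed
  have entry_span: "entry n a b * h \<in> fun_vs.span M" if ab: "a < n" "b < n" and h: "h \<in> fun_vs.span M" for a b h
    using h
  proof (induction rule: fun_vs.span_induct_alt)
    case base
    then show ?case using fun_vs.span_zero by (simp only: mult_zero_right)
  next
    case (step k x y)
    have "entry n a b * (fun_scale k x + y) = fun_scale k (entry n a b * x) + entry n a b * y"
      by (auto simp: fun_scale_def algebra_simps)
    then show ?case using step entry_M[OF ab step(1)]
      by (simp only: fun_vs.span_add fun_vs.span_scale fun_vs.span_base)
  qed
  fix f :: "'k mat \<Rightarrow> 'k"
  assume f: "f \<in> SL_ring n"
  \<comment> \<open>Showing that multiplication by \<open>f\<close> preserves the span reduces the
    product case to associativity. Applied to the empty monomial, the unit, it yields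
    \<open>f\<close> itself.\<close>
  have "\<forall>h\<in>fun_vs.span M. f * h \<in> fun_vs.span M"
    using f
  proof (rule coordinate_ring_induct)
    fix k
    have "restr (SL n) (\<lambda>_. k) * h = fun_scale k h" if "h \<in> fun_vs.span M" for h
    proof -
      have "fun_vs.span M \<subseteq> SL_ring n"
      proof (rule fun_vs.span_minimal)
        show "M \<subseteq> SL_ring n" by (auto simp: M_def intro!: entry_monomial_mem)
        show "fun_vs.subspace (SL_ring n)"
          by (simp add: fun_vs.subspace_def coordinate_ring_0 coordinate_ring_add coordinate_ring_scale)
      qed
      then show ?thesis
        using that coordinate_ring_outside[of h] by (fastforce simp: fun_scale_def restr_def fun_eq_iff)
    qed
    then show "\<forall>h\<in>fun_vs.span M. restr (SL n) (\<lambda>_. k) * h \<in> fun_vs.span M"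
      by (metis fun_vs.span_scale)
  next
    fix x :: "'k mat \<Rightarrow> 'k" assume "x \<in> matrix_entries n"
    then obtain a b where "a < n" "b < n" "x = (\<lambda>A. A $$ (a, b))" by (auto simp: matrix_entries_def)
    then show "\<forall>h\<in>fun_vs.span M. restr (SL n) x * h \<in> fun_vs.span M"
      using entry_span by (simp only: entry_def) blast
  next
    fix x y :: "'k mat \<Rightarrow> 'k"
    assume "\<forall>h\<in>fun_vs.span M. x * h \<in> fun_vs.span M" "\<forall>h\<in>fun_vs.span M. y * h \<in> fun_vs.span M"
    then show "\<forall>h\<in>fun_vs.span M. (x + y) * h \<in> fun_vs.span M"
      "\<forall>h\<in>fun_vs.span M. (x * y) * h \<in> fun_vs.span M"
      by (simp_all only: distrib_right mult.assoc) (blast intro: fun_vs.span_add)+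
  qed
  moreover have "entry_monomial n ({} :: nat set) (\<lambda>_. 0) (\<lambda>_. 0) \<in> fun_vs.span M"
    by (rule fun_vs.span_base) (auto simp: M_def)
  ultimately have "f * entry_monomial n ({} :: nat set) (\<lambda>_. 0) (\<lambda>_. 0) \<in> fun_vs.span M" by blast
  moreover have "f * entry_monomial n ({} :: nat set) (\<lambda>_. 0) (\<lambda>_. 0) = f"
    using coordinate_ring_outside[OF f] by (auto simp: entry_monomial_apply fun_eq_iff)
  moreover have "fun_vs.span M \<subseteq> row_span n"
    by (rule fun_vs.span_minimal[OF _ row_span_subspace])
      (auto simp: M_def intro!: entry_monomial_row_span[OF assms])
  ultimately show "f \<in> row_span n" by auto
qed

section \<open>A frame of the tangent bundle\<close>

text \<open>The adjugate has polynomial entries, and it is the inverse where the determinant is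
  \<open>1\<close>.\<close>

lemma SL_inverse_entries:
  "\<exists>B :: nat \<Rightarrow> nat \<Rightarrow> 'k::comm_ring_1 mat \<Rightarrow> 'k. (\<forall>k j. B k j \<in> SL_ring n) \<and>
    (\<forall>A\<in>SL n. \<forall>i<n. \<forall>j<n. (\<Sum>k<n. A $$ (i, k) * B k j A) = (if i = j then 1 else 0))"
proof -
  \<comment> \<open>\<open>e i\<close> enumerates the numbers other than \<open>i\<close> in order,
    matching the renumbering when row or column \<open>i\<close> is deleted.\<close>
  define e where "e i i' = (if i' < i then i' else Suc i')" for i i' :: nat
  define B :: "nat \<Rightarrow> nat \<Rightarrow> 'k mat \<Rightarrow> 'k" where
    "B k j = (if k < n \<and> j < n then restr (SL n) (\<lambda>A. adj_mat A $$ (k, j)) else 0)" for k j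
  have "B k j \<in> SL_ring n" for k j
  proof (cases "k < n \<and> j < n")
    case True
    have "B k j = fun_scale ((- 1) ^ (j + k)) (\<Sum>p | p permutes {0..<n - 1}. fun_scale (of_int (sign p))
        (restr (SL n) (\<Prod>i = 0..<n - 1. entry n (e j i) (e k (p i)))))"
    proof
      fix A :: "'k mat"
      show "B k j A = fun_scale ((- 1) ^ (j + k)) (\<Sum>p | p permutes {0..<n - 1}. fun_scale (of_int (sign p))
        (restr (SL n) (\<Prod>i = 0..<n - 1. entry n (e j i) (e k (p i))))) A"
      proof (cases "A \<in> SL n")
        case A: True
        have "det (mat_delete A j k) = (\<Sum>p | p permutes {0..<n - 1}. of_int (sign p) *
            (\<Prod>i = 0..<n - 1. mat_delete A j k $$ (i, p i)))"
          by (rule det_def'[OF mat_delete_carrier[OF SL_carrier[OF A]]])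
        also have "\<dots> = (\<Sum>p | p permutes {0..<n - 1}. of_int (sign p) * (\<Prod>i = 0..<n - 1. A $$ (e j i, e k (p i))))"
        proof (intro sum.cong refl arg_cong2[of _ _ _ _ "(*)"] prod.cong)
          fix p i assume p: "p \<in> {p. p permutes {0..<n - 1}}" and i: "i \<in> {0..<n - 1}"
          then have "p i < n - 1" using permutes_in_image[of p "{0..<n - 1}" i] by auto
          then show "mat_delete A j k $$ (i, p i) = A $$ (e j i, e k (p i))"
            using i SL_carrier[OF A] by (simp add: mat_delete_def e_def)
        qed
        finally show ?thesis
          using A True SL_carrier[OF A]
          by (simp add: B_def restr_def adj_mat_def cofactor_def fun_scale_def sum_fun_apply prod_fun_apply entry_apply)
      next
        case False
        then show ?thesis using True by (simp add: B_def restr_def fun_scale_def sum_fun_apply)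
      qed
    qed
    also have "\<dots> \<in> SL_ring n"
    proof (intro coordinate_ring_scale coordinate_ring_sum coordinate_ring_prod entry_mem)
      fix p i assume p: "p \<in> {p. p permutes {0..<n - 1}}" and i: "i \<in> {0..<n - 1}"
      then have "p i < n - 1" using permutes_in_image[of p "{0..<n - 1}" i] by auto
      then show "e j i < n" "e k (p i) < n" using i by (auto simp: e_def)
    qed
    finally show ?thesis .
  qed (auto simp: B_def coordinate_ring_0)
  moreover have "(\<Sum>k<n. A $$ (i, k) * B k j A) = (if i = j then 1 else 0)"
    if A: "A \<in> SL n" and ij: "i < n" "j < n" for A :: "'k mat" and i j
  proof -
    note adj = adj_mat[OF SL_carrier[OF A]]
    have "(\<Sum>k<n. A $$ (i, k) * B k j A) = (A * adj_mat A) $$ (i, j)"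
      using A ij SL_carrier[OF A] adj(1) by (simp add: B_def restr_def scalar_prod_def atLeast0LessThan)
    also have "\<dots> = (if i = j then 1 else 0)"
      using A ij adj(2) by (simp add: SL_def)
    finally show ?thesis .
  qed
  ultimately show ?thesis by blast
qed

text \<open>Left-invariant fields: \<open>(i, j)\<close> with \<open>i \<noteq> j\<close> stands for the elementary matrix \<open>E\<^sub>i\<^sub>j\<close>, and
  \<open>(i, i)\<close> for the traceless matrix \<open>E\<^sub>i\<^sub>i - E\<^sub>p\<^sub>p\<close> with \<open>p = n - 1\<close>.\<close>

definition frame_field :: "nat \<Rightarrow> nat \<times> nat \<Rightarrow> ('k::field_char_0 mat \<Rightarrow> 'k) \<Rightarrow> 'k mat \<Rightarrow> 'k" where
  "frame_field n = (\<lambda>(i, j). if i = j then commutator (col_field n i (n - 1)) (col_field n (n - 1) i)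
    else col_field n i j)"

text \<open>For \<open>n > 0\<close> these are \<open>n^2 - 1\<close> indices, the dimension of
  \<open>SL n\<close>. The index \<open>(n - 1, n - 1)\<close> is left out, as
  \<open>E_pp - E_pp\<close> vanishes.\<close>

definition frame_index :: "nat \<Rightarrow> (nat \<times> nat) set" where
  "frame_index n = off_diagonal n \<union> (\<lambda>i. (i, i)) ` {..<n - 1}"

lemma frame_field_Vec:
  assumes "q \<in> frame_index n"
  shows "(frame_field n q :: ('k::field_char_0 mat \<Rightarrow> 'k) \<Rightarrow> _) \<in> Vec_SL n"
proof (cases "fst q = snd q")
  case True
  then obtain i where i: "q = (i, i)" "i < n - 1"
    using assms by (auto simp: frame_index_def off_diagonal_def)
  have "commutator (col_field n i (n - 1)) (col_field n (n - 1) i :: ('k mat \<Rightarrow> 'k) \<Rightarrow> _) \<in> Vec_SL n"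
    unfolding Vec_SL_def
    by (intro commutator_Vec col_field_Vec[unfolded Vec_SL_def]) (use i in auto)
  then show ?thesis by (simp only: frame_field_def i prod.case simp_thms if_True)
next
  case False
  then show ?thesis
    using assms by (auto simp: frame_index_def frame_field_def off_diagonal_def intro!: col_field_Vec)
qed

lemma frame_field_off_diagonal: "i \<noteq> j \<Longrightarrow> frame_field n (i, j) = col_field n i j"
  by (simp add: frame_field_def)

text \<open>This is \<open>[E_ip, E_pi] = E_ii - E_pp\<close> with \<open>p = n - 1\<close>, read
  off on the columns.\<close>

lemma frame_field_diagonal_entry:
  assumes i: "i < n - 1" and ab: "a < n" "b < n"
  shows "frame_field n (i, i) (entry n a b) =
    (if b = i then entry n a b else if b = n - 1 then - entry n a b else (0 :: 'k::field_char_0 mat \<Rightarrow> 'k))"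
proof -
  define p where "p = n - 1"
  have ip: "i < n" "p < n" "i \<noteq> p" "p \<noteq> i" using i by (auto simp: p_def)
  note 1 = col_field_entry[OF ip(1,2,3)] and 2 = col_field_entry[OF ip(2,1,4)]
  note 0 = Vec_SL_zero[OF col_field_Vec[OF ip(1,2,3)]] Vec_SL_zero[OF col_field_Vec[OF ip(2,1,4)]]
  show ?thesis
    using ip ab unfolding frame_field_def p_def[symmetric] by (auto simp: commutator_def 1 2 0)
qed

lemma Vec_SL_uminus:
  assumes "D \<in> Vec_SL n" "f \<in> SL_ring n"
  shows "D (- f) = - D (f :: 'k::field_char_0 mat \<Rightarrow> 'k)"
  using Vec_0_diff[of D "matrix_entries n" "SL n"] assms coordinate_ring_0
  unfolding Vec_SL_def by (metis diff_0)

text \<open>One field changes row indices and the other column indices, as left and right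
  multiplication commute; comparing entries suffices.\<close>

lemma commutator_row_frame:
  assumes ij: "i < n" "j < n" "i \<noteq> j" and q: "q \<in> frame_index n"
  shows "commutator (row_field n i j) (frame_field n q) = (0 :: ('k::field_char_0 mat \<Rightarrow> 'k) \<Rightarrow> _)"
proof (rule Vec_SL_eqI)
  note r = row_field_Vec[OF ij] row_field_entry[OF ij]
  note f = frame_field_Vec[OF q]
  show "commutator (row_field n i j) (frame_field n q) \<in> Vec_SL n"
    using r(1) f unfolding Vec_SL_def by (rule commutator_Vec)
  show "(0 :: ('k mat \<Rightarrow> 'k) \<Rightarrow> _) \<in> Vec_SL n"
    using Vec_sum[of "{}"] by (simp add: Vec_SL_def)
  fix a b assume ab: "a < n" "b < n"
  consider (off) k l where "q = (k, l)" "k < n" "l < n" "k \<noteq> l" | (diag) k where "q = (k, k)" "k < n - 1"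
    using q by (auto simp: frame_index_def off_diagonal_def)
  then show "commutator (row_field n i j) (frame_field n q) (entry n a b) = (0 :: ('k mat \<Rightarrow> 'k) \<Rightarrow> _) (entry n a b)"
  proof cases
    case off
    note c = col_field_entry[OF off(2,3,4)]
    show ?thesis
      using ab ij off
      by (simp add: commutator_def frame_field_off_diagonal r(2) c Vec_SL_zero[OF r(1)]
          Vec_SL_zero[OF col_field_Vec[OF off(2,3,4)]])
  next
    case diag
    note c = frame_field_diagonal_entry[OF diag(2)]
    have "n - 1 < n" "k < n" using ab diag by auto
    then show ?thesis
      using ab ij diag(1)
      by (simp add: commutator_def r(2) c Vec_SL_zero[OF r(1)] Vec_SL_zero[OF f[unfolded diag(1)]] Vec_SL_uminus[OF r(1)] entry_mem)
  qed
qed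

text \<open>The Leibniz formula on \<open>SL n\<close> lets a derivation be applied to the relation
  \<open>det A = 1\<close>.\<close>

lemma det_eq_sum_monomials:
  "restr (SL n) (\<lambda>_. 1) = (\<Sum>\<sigma> | \<sigma> permutes {..<n}. fun_scale (of_int (sign \<sigma>))
    (restr (SL n) (\<Prod>b<n. entry n (\<sigma> b) b)) :: 'k::comm_ring_1 mat \<Rightarrow> 'k)"
proof
  fix A :: "'k mat"
  show "restr (SL n) (\<lambda>_. 1) A = (\<Sum>\<sigma> | \<sigma> permutes {..<n}. fun_scale (of_int (sign \<sigma>))
    (restr (SL n) (\<Prod>b<n. entry n (\<sigma> b) b))) A"
  proof (cases "A \<in> SL n")
    case True
    then have "det A = 1" by (simp add: SL_def)
    then show ?thesis
      using det_col[OF SL_carrier[OF True]] True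
      by (simp add: restr_def fun_scale_def sum_fun_apply prod_fun_apply entry_apply atLeast0LessThan)
  qed (simp add: restr_def fun_scale_def sum_fun_apply)
qed

text \<open>Such a \<open>D\<close> multiplies the determinant by \<open>g\<close>, but it kills the constant \<open>1\<close>.\<close>

lemma column_multiplier_zero:
  fixes D :: "('k::field_char_0 mat \<Rightarrow> 'k) \<Rightarrow> 'k mat \<Rightarrow> 'k"
  assumes D: "D \<in> Vec_SL n" and p: "p < n" and g: "g \<in> SL_ring n"
    and D_entry: "\<And>a b. a < n \<Longrightarrow> b < n \<Longrightarrow> D (entry n a b) = (if b = p then g * entry n a p else 0)"
  shows "g = 0"
proof -
  let ?V = "matrix_entries n :: ('k mat \<Rightarrow> 'k) set"
  have D': "D \<in> Vec ?V (SL n)" using D by (simp add: Vec_SL_def)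
  have mem: "entry n (\<sigma> b) b \<in> SL_ring n" if "\<sigma> permutes {..<n}" "b < n" for \<sigma> b
    using that permutes_in_image[of \<sigma> "{..<n}" b] by (auto intro: entry_mem)
  \<comment> \<open>Each monomial of the determinant has exactly one factor from column
    \<open>p\<close>, and \<open>D\<close> kills the other factors.\<close>
  have step: "D (restr (SL n) (\<Prod>b<n. entry n (\<sigma> b) b)) = g * restr (SL n) (\<Prod>b<n. entry n (\<sigma> b) b)"
    if \<sigma>: "\<sigma> permutes {..<n}" for \<sigma>
  proof -
    let ?P = "\<lambda>b. restr (SL n) (\<Prod>c\<in>{..<n} - {b}. entry n (\<sigma> c) c)"
    have \<sigma>n: "\<sigma> b < n" if "b < n" for b using that permutes_in_image[OF \<sigma>, of b] by simp
    have "D (restr (SL n) (\<Prod>b<n. entry n (\<sigma> b) b)) = (\<Sum>b<n. D (entry n (\<sigma> b) b) * ?P b)"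
      by (rule Vec_prod[OF D']) (use mem[OF \<sigma>] in auto)
    also have "\<dots> = (\<Sum>b<n. if b = p then g * entry n (\<sigma> p) p * ?P p else 0)"
      by (rule sum.cong[OF refl]) (use \<sigma>n in \<open>simp add: D_entry\<close>)
    also have "\<dots> = g * (entry n (\<sigma> p) p * ?P p)" using p by (simp add: mult.assoc)
    also have "entry n (\<sigma> p) p * ?P p = restr (SL n) (\<Prod>b\<in>insert p ({..<n} - {p}). entry n (\<sigma> b) b)"
      by (rule restr_prod_insert[where f = "\<lambda>b. entry n (\<sigma> b) b", symmetric]) (use mem[OF \<sigma>] p in auto)
    also have "insert p ({..<n} - {p}) = {..<n}" using p by auto
    finally show ?thesis .
  qed
  have "D (restr (SL n) (\<lambda>_. 1)) = (\<Sum>\<sigma> | \<sigma> permutes {..<n}. D (fun_scale (of_int (sign \<sigma>))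
      (restr (SL n) (\<Prod>b<n. entry n (\<sigma> b) b))))"
    unfolding det_eq_sum_monomials
    by (rule Vec_sum_apply[OF D'])
      (use mem in \<open>auto intro!: coordinate_ring_scale coordinate_ring_prod\<close>)
  also have "\<dots> = (\<Sum>\<sigma> | \<sigma> permutes {..<n}. g * fun_scale (of_int (sign \<sigma>))
      (restr (SL n) (\<Prod>b<n. entry n (\<sigma> b) b)))"
  proof (rule sum.cong[OF refl])
    fix \<sigma> assume "\<sigma> \<in> {\<sigma>. \<sigma> permutes {..<n}}"
    then have \<sigma>: "\<sigma> permutes {..<n}" by simp
    have "restr (SL n) (\<Prod>b<n. entry n (\<sigma> b) b) \<in> SL_ring n"
      by (rule coordinate_ring_prod) (use mem[OF \<sigma>] in auto)
    from VecD(3)[OF D' this, of "of_int (sign \<sigma>)"]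
    show "D (fun_scale (of_int (sign \<sigma>)) (restr (SL n) (\<Prod>b<n. entry n (\<sigma> b) b))) =
        g * fun_scale (of_int (sign \<sigma>)) (restr (SL n) (\<Prod>b<n. entry n (\<sigma> b) b))"
      by (simp only: step[OF \<sigma>]) (simp add: fun_scale_def fun_eq_iff)
  qed
  also have "\<dots> = g * restr (SL n) (\<lambda>_. 1)"
    by (simp only: sum_distrib_left[symmetric] det_eq_sum_monomials[symmetric])
  also have "\<dots> = g" using coordinate_ring_outside[OF g] by (auto simp: restr_def fun_eq_iff)
  finally show ?thesis using Vec_const[OF D', of 1] by simp
qed

text \<open>Write the matrix of values \<open>D(A)\<close> as \<open>A F\<close> with
  \<open>F = A^(-1) D(A)\<close>. The frame realises traceless matrices only, so the trace of
  \<open>F\<close> must be shown to vanish.\<close>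

lemma Vec_SL_frame:
  fixes D :: "('k::field_char_0 mat \<Rightarrow> 'k) \<Rightarrow> 'k mat \<Rightarrow> 'k"
  assumes D: "D \<in> Vec_SL n" and n: "n > 0"
  shows "\<exists>F. (\<forall>q. F q \<in> SL_ring n) \<and> D = (\<Sum>q\<in>frame_index n. vf_mult (F q) (frame_field n q))"
proof -
  define p where "p = n - 1"
  have p: "p < n" using n by (simp add: p_def)
  have D': "D \<in> Vec (matrix_entries n) (SL n)" using D by (simp add: Vec_SL_def)
  obtain B :: "nat \<Rightarrow> nat \<Rightarrow> 'k mat \<Rightarrow> 'k" where B: "\<And>k j. B k j \<in> SL_ring n"
    and inv: "\<And>A i j. A \<in> SL n \<Longrightarrow> i < n \<Longrightarrow> j < n \<Longrightarrow> (\<Sum>k<n. A $$ (i, k) * B k j A) = (if i = j then 1 else 0)"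
    using SL_inverse_entries[of n, where 'k = 'k] by blast
  \<comment> \<open>This is the matrix \<open>A^(-1) D(A)\<close>.\<close>
  define F where "F = (\<lambda>(k, b). \<Sum>j<n. B k j * D (entry n j b))"
  have F: "F q \<in> SL_ring n" for q
    by (auto simp: F_def split: prod.split intro!: coordinate_ring_sum coordinate_ring_mult B VecD(1)[OF D'])
  have D_entry: "D (entry n a b) = (\<Sum>k<n. entry n a k * F (k, b))" if ab: "a < n" "b < n" for a b
  proof
    fix A :: "'k mat"
    show "D (entry n a b) A = (\<Sum>k<n. entry n a k * F (k, b)) A"
    proof (cases "A \<in> SL n")
      case True
      have "(\<Sum>k<n. entry n a k * F (k, b)) A = (\<Sum>k<n. \<Sum>j<n. A $$ (a, k) * B k j A * D (entry n j b) A)"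
        using True by (simp add: F_def sum_fun_apply entry_apply sum_distrib_left mult.assoc)
      also have "\<dots> = (\<Sum>j<n. (\<Sum>k<n. A $$ (a, k) * B k j A) * D (entry n j b) A)"
        by (subst sum.swap) (simp add: sum_distrib_right)
      also have "\<dots> = (\<Sum>j<n. if a = j then D (entry n j b) A else 0)"
        by (rule sum.cong[OF refl]) (simp add: inv[OF True ab(1)])
      also have "\<dots> = D (entry n a b) A" using ab by simp
      finally show ?thesis by simp
    next
      case False
      then show ?thesis
        using coordinate_ring_outside[OF VecD(1)[OF D']] by (simp add: sum_fun_apply entry_apply)
    qed
  qed
  define E where "E = (\<Sum>q\<in>frame_index n. vf_mult (F q) (frame_field n q))"
  have E: "E \<in> Vec (matrix_entries n) (SL n)"
    unfolding E_def using frame_field_Vec F by (intro Vec_sum vf_mult_Vec) (auto simp: Vec_SL_def)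
  define tr where "tr = (\<Sum>i<n. F (i, i))"
  \<comment> \<open>All columns but \<open>p\<close> come out right. In column \<open>p\<close> the
    frame uses \<open>- (\<Sum>i<p. F (i, i))\<close>, that is \<open>F (p, p) - tr\<close>, in
    place of \<open>F (p, p)\<close>.\<close>
  have E_entry: "E (entry n a b) = D (entry n a b) - (if b = p then tr * entry n a p else 0)"
    if ab: "a < n" "b < n" for a b
  proof -
    have disj: "off_diagonal n \<inter> (\<lambda>i. (i, i)) ` {..<p} = {}" by (auto simp: off_diagonal_def)
    have "E (entry n a b) = (\<Sum>q\<in>frame_index n. F q * frame_field n q (entry n a b))"
      by (simp add: E_def sum_fun_apply vf_mult_def)
    also have "\<dots> = (\<Sum>q\<in>off_diagonal n. F q * frame_field n q (entry n a b)) +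
        (\<Sum>i<p. F (i, i) * frame_field n (i, i) (entry n a b))"
      unfolding frame_index_def p_def[symmetric]
      by (subst sum.union_disjoint[OF finite_off_diagonal _ disj]) (auto simp: sum.reindex inj_on_def)
    \<comment> \<open>Among the off-diagonal fields only those with index \<open>(i, b)\<close> move
      column \<open>b\<close>.\<close>
    also have "(\<Sum>q\<in>off_diagonal n. F q * frame_field n q (entry n a b)) =
        (\<Sum>q\<in>(\<lambda>i. (i, b)) ` ({..<n} - {b}). F q * entry n a (fst q))"
    proof (rule sum.mono_neutral_cong_right[OF finite_off_diagonal])
      show "(\<lambda>i. (i, b)) ` ({..<n} - {b}) \<subseteq> off_diagonal n" using ab by (auto simp: off_diagonal_def)
      show "\<forall>q\<in>off_diagonal n - (\<lambda>i. (i, b)) ` ({..<n} - {b}). F q * frame_field n q (entry n a b) = 0"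
        using ab by (auto simp: off_diagonal_def frame_field_off_diagonal col_field_entry)
      show "F q * frame_field n q (entry n a b) = F q * entry n a (fst q)"
        if "q \<in> (\<lambda>i. (i, b)) ` ({..<n} - {b})" for q
        using that ab by (auto simp: frame_field_off_diagonal col_field_entry)
    qed
    also have "\<dots> = (\<Sum>i\<in>{..<n} - {b}. F (i, b) * entry n a i)"
      by (simp add: sum.reindex inj_on_def)
    also have "\<dots> = D (entry n a b) - F (b, b) * entry n a b"
      using ab by (simp add: D_entry[OF ab] sum_diff1 mult.commute)
    also have "(\<Sum>i<p. F (i, i) * frame_field n (i, i) (entry n a b)) =
        F (b, b) * entry n a b - (if b = p then tr * entry n a p else 0)"
    proof (cases "b = p")
      case True
      have "(\<Sum>i<p. F (i, i) * frame_field n (i, i) (entry n a b)) = (\<Sum>i<p. - (F (i, i) * entry n a p))"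
        by (rule sum.cong[OF refl]) (use True ab in \<open>auto simp: p_def frame_field_diagonal_entry\<close>)
      also have "\<dots> = - ((\<Sum>i<p. F (i, i)) * entry n a p)" by (simp add: sum_negf sum_distrib_right)
      also have "(\<Sum>i<p. F (i, i)) = tr - F (p, p)"
      proof -
        have "n = Suc p" using n by (simp add: p_def)
        then show ?thesis by (simp add: tr_def)
      qed
      finally show ?thesis using True by (simp only: left_diff_distrib minus_diff_eq if_True simp_thms)
    next
      case False
      then have b: "b < p" using ab by (simp add: p_def)
      have "(\<Sum>i<p. F (i, i) * frame_field n (i, i) (entry n a b)) =
          (\<Sum>i<p. if i = b then F (b, b) * entry n a b else 0)"
        by (rule sum.cong[OF refl]) (use False ab in \<open>auto simp: p_def frame_field_diagonal_entry\<close>)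
      then show ?thesis using b False by simp
    qed
    finally show ?thesis by (simp only: add_diff_eq diff_add_cancel)
  qed
  have DE: "D - E \<in> Vec_SL n"
  proof -
    interpret lie_algebra op_scale "Vec (matrix_entries n) (SL n)" "commutator :: (('k mat \<Rightarrow> 'k) \<Rightarrow> _) \<Rightarrow> _"
      by (rule lie_algebra_Vec)
    show ?thesis using subspace_diff[OF subspace_carrier D' E] by (simp add: Vec_SL_def)
  qed
  have trR: "tr \<in> SL_ring n" unfolding tr_def by (intro coordinate_ring_sum F)
  \<comment> \<open>\<open>D - E\<close> multiplies column \<open>p\<close> by \<open>tr\<close> and
    kills the other columns, so it would scale the determinant by \<open>tr\<close>.\<close>
  have "tr = 0"
  proof (rule column_multiplier_zero[OF DE p trR])
    fix a b assume "a < n" "b < n"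
    then show "(D - E) (entry n a b) = (if b = p then tr * entry n a p else 0)"
      by (simp add: E_entry)
  qed
  then have "D = E"
    using D E by (intro Vec_SL_eqI[of D n E]) (auto simp: E_entry Vec_SL_def)
  then show ?thesis using F unfolding E_def by blast
qed

section \<open>Counting brackets\<close>

context lie_algebra
begin

lemma sum_of_brackets_0: "sum_of_brackets 0 0"
  by (simp add: sum_of_brackets_def)

lemma sum_of_brackets_add_bracket:
  assumes "sum_of_brackets m w" and u: "u \<in> L" and v: "v \<in> L"
  shows "sum_of_brackets (Suc m) (bracket u v + w)"
proof -
  from assms(1) obtain x y where
    xy: "\<forall>i<m. x i \<in> L \<and> y i \<in> L" "w = (\<Sum>i<m. bracket (x i) (y i))"
    unfolding sum_of_brackets_def by blast
  then show ?thesis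
    unfolding sum_of_brackets_def using u v
    by (intro exI[of _ "x(m := u)"] exI[of _ "y(m := v)"]) (auto simp: less_Suc_eq add.commute intro!: sum.cong)
qed

lemma sum_of_brackets_mono:
  assumes "sum_of_brackets m w" "m \<le> k"
  shows "sum_of_brackets k w"
  using assms(2,1)
proof (induction rule: dec_induct)
  case (step i)
  have "0 \<in> L" by (rule subspace_0[OF subspace_carrier])
  then show ?case
    using sum_of_brackets_add_bracket[of i w 0 0] step bracket_self[of 0] by simp
qed simp

lemma sum_of_brackets_sum:
  assumes "finite J" "\<And>j. j \<in> J \<Longrightarrow> x j \<in> L" "\<And>j. j \<in> J \<Longrightarrow> y j \<in> L" "sum_of_brackets m w"
  shows "sum_of_brackets (card J + m) ((\<Sum>j\<in>J. bracket (x j) (y j)) + w)"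
  using assms
proof (induction J)
  case (insert j J)
  then have "sum_of_brackets (card J + m) ((\<Sum>j\<in>J. bracket (x j) (y j)) + w)" by simp
  from sum_of_brackets_add_bracket[OF this, of "x j" "y j"] insert show ?case
    by (simp add: add.assoc)
qed simp

end

text \<open>\<open>H\<close> is the torus element with weights \<open>1, 2, \<dots>, n - 1\<close> and minus their sum; as these are
  distinct, \<open>ad H\<close> is invertible on the off-diagonal fields.\<close>

lemma off_diagonal_combination_commutator:
  fixes c :: "nat \<times> nat \<Rightarrow> 'k::field_char_0"
  shows "\<exists>H\<in>Vec_SL n. \<exists>K\<in>Vec_SL n.
    (\<Sum>q\<in>off_diagonal n. op_scale (c q) (frame_field n q)) = commutator H K"
proof -
  interpret lie_algebra op_scale "Vec_SL n" "commutator :: (('k mat \<Rightarrow> 'k) \<Rightarrow> _) \<Rightarrow> _"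
    by (rule lie_algebra_Vec_SL)
  define p where "p = n - 1"
  define H :: "('k mat \<Rightarrow> 'k) \<Rightarrow> _" where
    "H = (\<Sum>i<p. op_scale (of_nat (Suc i)) (frame_field n (i, i)))"
  define s where "s = (\<Sum>i<p. Suc i)"
  define wt :: "nat \<Rightarrow> 'k" where "wt b = (if b = p then - of_nat s else of_nat (Suc b))" for b
  have frame: "(frame_field n q :: ('k mat \<Rightarrow> 'k) \<Rightarrow> _) \<in> Vec_SL n" if "q \<in> off_diagonal n \<or> (\<exists>i<p. q = (i, i))" for q
    using that by (intro frame_field_Vec) (auto simp: frame_index_def p_def)
  have H: "H \<in> Vec_SL n"
    unfolding H_def using frame
    by (intro subspace_sum[OF subspace_carrier] subspace_scale[OF subspace_carrier]) auto
  have H_entry: "H (entry n a b) = fun_scale (wt b) (entry n a b)" if ab: "a < n" "b < n" for a b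
  proof
    fix A
    have "H (entry n a b) A = (\<Sum>i<p. of_nat (Suc i) * frame_field n (i, i) (entry n a b) A)"
      by (simp add: H_def sum_fun_apply op_scale_def fun_scale_def)
    also have "\<dots> = wt b * entry n a b A"
    proof (cases "b = p")
      case True
      have "(\<Sum>i<p. of_nat (Suc i) * frame_field n (i, i) (entry n a b) A) = (\<Sum>i<p. of_nat (Suc i) * - entry n a b A)"
        by (rule sum.cong[OF refl]) (use True ab in \<open>auto simp: p_def frame_field_diagonal_entry\<close>)
      also have "\<dots> = - of_nat s * entry n a b A"
        unfolding s_def of_nat_sum sum_distrib_right minus_mult_commute ..
      finally show ?thesis using True by (simp add: wt_def)
    next
      case False
      then have "b < p" using ab by (simp add: p_def)
      have "(\<Sum>i<p. of_nat (Suc i) * frame_field n (i, i) (entry n a b) A) =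
          (\<Sum>i<p. if i = b then of_nat (Suc b) * entry n a b A else 0)"
        by (rule sum.cong[OF refl]) (use False ab in \<open>auto simp: p_def frame_field_diagonal_entry\<close>)
      then show ?thesis using False \<open>b < p\<close> by (simp add: wt_def)
    qed
    finally show "H (entry n a b) A = fun_scale (wt b) (entry n a b) A" by (simp add: fun_scale_def)
  qed
  \<comment> \<open>In characteristic zero the positive integers \<open>Suc b\<close> differ from
    one another and from \<open>- s\<close>, since \<open>s\<close> is nonnegative.\<close>
  have wt_inj: "wt i \<noteq> wt j" if "i \<noteq> j" for i j
  proof -
    have neg: "- of_nat s \<noteq> (of_nat (Suc b) :: 'k)" for b
    proof
      assume "- of_nat s = (of_nat (Suc b) :: 'k)"
      then have "of_nat (Suc b + s) = (0 :: 'k)"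
        unfolding of_nat_add by (metis add.left_inverse add.commute)
      then show False by (simp only: of_nat_eq_0_iff)
    qed
    show ?thesis using that neg[of i] neg[of j] by (auto simp: wt_def simp del: of_nat_Suc)
  qed
  have comm: "commutator H (frame_field n (i, j)) = op_scale (wt i - wt j) (frame_field n (i, j))"
    if ij: "(i, j) \<in> off_diagonal n" for i j
  proof (rule Vec_SL_eqI)
    have ij': "i < n" "j < n" "i \<noteq> j" using ij by (auto simp: off_diagonal_def)
    show "commutator H (frame_field n (i, j)) \<in> Vec_SL n" using H frame ij by (intro bracket_closed) auto
    show "op_scale (wt i - wt j) (frame_field n (i, j)) \<in> Vec_SL n"
      using frame ij by (intro subspace_scale[OF subspace_carrier]) auto
    fix a b assume ab: "a < n" "b < n"
    have "col_field n i j (fun_scale (wt b) (entry n a b)) = fun_scale (wt b) (col_field n i j (entry n a b))"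
      by (rule VecD(3)[OF col_field_Vec[OF ij', unfolded Vec_SL_def] entry_mem[OF ab]])
    then show "commutator H (frame_field n (i, j)) (entry n a b) =
        op_scale (wt i - wt j) (frame_field n (i, j)) (entry n a b)"
      using ab ij' Vec_SL_zero[OF H]
      by (auto simp: commutator_def op_scale_def frame_field_off_diagonal col_field_entry H_entry
          fun_scale_def fun_eq_iff algebra_simps)
  qed
  \<comment> \<open>By \<open>comm\<close>, the field with index \<open>(i, j)\<close> is an
    eigenvector of \<open>ad H\<close> for \<open>wt i - wt j\<close>; dividing by these eigenvalues
    gives a preimage.\<close>
  define K :: "('k mat \<Rightarrow> 'k) \<Rightarrow> _" where
    "K = (\<Sum>q\<in>off_diagonal n. op_scale (c q / (wt (fst q) - wt (snd q))) (frame_field n q))"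
  have K: "K \<in> Vec_SL n"
    unfolding K_def using frame
    by (intro subspace_sum[OF subspace_carrier] subspace_scale[OF subspace_carrier]) auto
  have "commutator H K = (\<Sum>q\<in>off_diagonal n. commutator H (op_scale (c q / (wt (fst q) - wt (snd q))) (frame_field n q)))"
    unfolding K_def
    by (rule commutator_sum_right[where C = "matrix_entries n" and X = "SL n", folded Vec_SL_def, OF H])
      (use frame in \<open>auto intro: subspace_scale[OF subspace_carrier]\<close>)
  also have "\<dots> = (\<Sum>q\<in>off_diagonal n. op_scale (c q) (frame_field n q))"
  proof (rule sum.cong[OF refl])
    fix q assume q: "q \<in> off_diagonal n"
    obtain i j where ij: "q = (i, j)" by fastforce
    have "wt i - wt j \<noteq> 0" using wt_inj[of i j] q ij by (auto simp: off_diagonal_def)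
    then show "commutator H (op_scale (c q / (wt (fst q) - wt (snd q))) (frame_field n q)) =
        op_scale (c q) (frame_field n q)"
      using q ij frame[of q] comm[of i j] by (simp add: bracket_scale_right[OF H])
  qed
  finally show ?thesis using H K by metis
qed

section \<open>Assembling the brackets\<close>

lemma vf_mult_sum_left: "vf_mult (\<Sum>i\<in>I. g i) D = (\<Sum>i\<in>I. vf_mult (g i) D)"
  by (simp add: vf_mult_def fun_eq_iff sum_fun_apply sum_distrib_right)

lemma vf_mult_add_left: "vf_mult (g + h) D = vf_mult g D + vf_mult h D"
  by (simp add: vf_mult_def fun_eq_iff algebra_simps)

text \<open>The count is \<open>n * n - n\<close> brackets with row fields, \<open>n - 1\<close> for
  the diagonal constants and one for the off-diagonal constants. It holds for every vector field on
  \<open>SL n\<close>.\<close>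

lemma Vec_SL_sum_of_brackets:
  fixes z :: "('k::field_char_0 mat \<Rightarrow> 'k) \<Rightarrow> 'k mat \<Rightarrow> 'k"
  assumes z: "z \<in> Vec_SL n" and n: "n > 0"
  shows "lie_algebra.sum_of_brackets (Vec_SL n) commutator (n * n) z"
proof -
  interpret lie_algebra op_scale "Vec_SL n" "commutator :: (('k mat \<Rightarrow> 'k) \<Rightarrow> _) \<Rightarrow> _"
    by (rule lie_algebra_Vec_SL)
  let ?off = "off_diagonal n" and ?ix = "frame_index n"
  obtain F where F: "\<And>q. F q \<in> SL_ring n" and zF: "z = (\<Sum>q\<in>?ix. vf_mult (F q) (frame_field n q))"
    using Vec_SL_frame[OF z n] by metis
  have ex: "\<forall>q. \<exists>c g. (\<forall>o'. g o' \<in> SL_ring n) \<and>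
      F q = restr (SL n) (\<lambda>_. c) + (\<Sum>(i, j)\<in>?off. row_field n i j (g (i, j)))"
  proof
    fix q
    have "F q \<in> row_span n" using F SL_ring_row_span[OF n] by blast
    then show "\<exists>c g. (\<forall>o'. g o' \<in> SL_ring n) \<and>
        F q = restr (SL n) (\<lambda>_. c) + (\<Sum>(i, j)\<in>?off. row_field n i j (g (i, j)))"
      unfolding row_span_def by blast
  qed
  from choice[OF ex] obtain c where ex': "\<forall>q. \<exists>g. (\<forall>o'. g o' \<in> SL_ring n) \<and>
      F q = restr (SL n) (\<lambda>_. c q) + (\<Sum>(i, j)\<in>?off. row_field n i j (g (i, j)))" by blast
  from choice[OF ex'] obtain g where g: "\<And>q o'. g q o' \<in> SL_ring n" and
    Fq: "\<And>q. F q = restr (SL n) (\<lambda>_. c q) + (\<Sum>(i, j)\<in>?off. row_field n i j (g q (i, j)))"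
    by blast
  \<comment> \<open>\<open>W\<close> gathers, for a fixed row field, the contributions of all frame
    fields, so that one bracket per row field serves the whole frame.\<close>
  define W where "W o' = (\<Sum>q\<in>?ix. vf_mult (g q o') (frame_field n q))" for o'
  have frameV: "(frame_field n q :: ('k mat \<Rightarrow> 'k) \<Rightarrow> _) \<in> Vec (matrix_entries n) (SL n)" if "q \<in> ?ix" for q
    using frame_field_Vec[OF that] by (simp add: Vec_SL_def)
  have W: "W o' \<in> Vec_SL n" for o'
    unfolding W_def Vec_SL_def by (intro Vec_sum vf_mult_Vec frameV g)
  have row: "commutator (row_field n i j) (W (i, j)) =
      (\<Sum>q\<in>?ix. vf_mult (row_field n i j (g q (i, j))) (frame_field n q))" if "(i, j) \<in> ?off" for i j
  proof -
    have ij: "i < n" "j < n" "i \<noteq> j" using that by (auto simp: off_diagonal_def)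
    note rV = row_field_Vec[OF ij, unfolded Vec_SL_def]
    have "commutator (row_field n i j) (W (i, j)) =
        (\<Sum>q\<in>?ix. commutator (row_field n i j) (vf_mult (g q (i, j)) (frame_field n q)))"
      unfolding W_def by (rule commutator_sum_right[OF rV]) (intro vf_mult_Vec frameV g)
    also have "\<dots> = (\<Sum>q\<in>?ix. vf_mult (row_field n i j (g q (i, j))) (frame_field n q))"
      by (rule sum.cong[OF refl]) (rule commutator_vf_mult[OF rV frameV g commutator_row_frame[OF ij]])
    finally show ?thesis .
  qed
  have "z = (\<Sum>q\<in>?ix. op_scale (c q) (frame_field n q)) +
      (\<Sum>q\<in>?ix. \<Sum>o'\<in>?off. vf_mult (row_field n (fst o') (snd o') (g q o')) (frame_field n q))"
    unfolding zF sum.distrib[symmetric]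
    by (rule sum.cong[OF refl])
      (simp only: Fq vf_mult_add_left vf_mult_sum_left vf_mult_const[OF frameV] case_prod_beta prod.collapse)
  also have "(\<Sum>q\<in>?ix. \<Sum>o'\<in>?off. vf_mult (row_field n (fst o') (snd o') (g q o')) (frame_field n q)) =
      (\<Sum>o'\<in>?off. commutator (row_field n (fst o') (snd o')) (W o'))"
    by (subst sum.swap, rule sum.cong[OF refl]) (use row in auto)
  \<comment> \<open>The diagonal frame fields are brackets by definition; the scalar moves into the
    left factor.\<close>
  also have "(\<Sum>q\<in>?ix. op_scale (c q) (frame_field n q)) =
      (\<Sum>q\<in>?off. op_scale (c q) (frame_field n q)) +
      (\<Sum>i<n - 1. commutator (op_scale (c (i, i)) (col_field n i (n - 1))) (col_field n (n - 1) i))"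
  proof -
    have "(\<Sum>i<n - 1. op_scale (c (i, i)) (frame_field n (i, i))) =
        (\<Sum>i<n - 1. commutator (op_scale (c (i, i)) (col_field n i (n - 1)))
          (col_field n (n - 1) i) :: ('k mat \<Rightarrow> 'k) \<Rightarrow> _)"
    proof (rule sum.cong[OF refl])
      fix i assume "i \<in> {..<n - 1}"
      then have i: "i < n" "n - 1 < n" "i \<noteq> n - 1" by auto
      have "commutator (op_scale (c (i, i)) (col_field n i (n - 1))) (col_field n (n - 1) i) =
          op_scale (c (i, i)) (commutator (col_field n i (n - 1)) (col_field n (n - 1) i) :: ('k mat \<Rightarrow> 'k) \<Rightarrow> _)"
        using i by (intro bracket_scale_left col_field_Vec) auto
      then show "op_scale (c (i, i)) (frame_field n (i, i) :: ('k mat \<Rightarrow> 'k) \<Rightarrow> _) =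
          commutator (op_scale (c (i, i)) (col_field n i (n - 1))) (col_field n (n - 1) i)"
        by (simp only: frame_field_def prod.case simp_thms if_True)
    qed
    moreover have "?off \<inter> (\<lambda>i. (i, i)) ` {..<n - 1} = {}" by (auto simp: off_diagonal_def)
    ultimately show ?thesis
      unfolding frame_index_def
      by (subst sum.union_disjoint[OF finite_off_diagonal]) (auto simp: sum.reindex inj_on_def)
  qed
  finally have z_eq: "z = (\<Sum>o'\<in>?off. commutator (row_field n (fst o') (snd o')) (W o')) +
      ((\<Sum>i<n - 1. commutator (op_scale (c (i, i)) (col_field n i (n - 1))) (col_field n (n - 1) i)) +
      (\<Sum>q\<in>?off. op_scale (c q) (frame_field n q)))"
    by (simp only: ac_simps)
  obtain H K where HK: "H \<in> Vec_SL n" "K \<in> Vec_SL n"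
    "(\<Sum>q\<in>?off. op_scale (c q) (frame_field n q)) = commutator H K"
    using off_diagonal_combination_commutator[of n c] by blast
  have "sum_of_brackets (Suc 0) (\<Sum>q\<in>?off. op_scale (c q) (frame_field n q))"
    using sum_of_brackets_add_bracket[OF sum_of_brackets_0 HK(1,2)] HK(3) by simp
  then have "sum_of_brackets (card {..<n - 1} + Suc 0)
      ((\<Sum>i<n - 1. commutator (op_scale (c (i, i)) (col_field n i (n - 1))) (col_field n (n - 1) i)) +
      (\<Sum>q\<in>?off. op_scale (c q) (frame_field n q)))"
    by (intro sum_of_brackets_sum) (auto intro!: subspace_scale[OF subspace_carrier] col_field_Vec)
  then have "sum_of_brackets (card ?off + (card {..<n - 1} + Suc 0)) z"
    unfolding z_eq
    by (intro sum_of_brackets_sum[OF finite_off_diagonal])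
      (auto simp: off_diagonal_def intro!: row_field_Vec W)
  moreover have "card ?off + (card {..<n - 1} + Suc 0) \<le> n * n"
    using n by (simp add: card_off_diagonal)
  ultimately show ?thesis by (rule sum_of_brackets_mono)
qed

theorem mainTheorem3:
  fixes n :: nat
  assumes "n > 0"
  shows "lie_algebra.bracket_width op_scale
      (Vec_SL n :: (('k::{alg_closed_field, field_char_0} mat \<Rightarrow> 'k) \<Rightarrow> 'k mat \<Rightarrow> 'k) set)
      commutator \<le> enat (n\<^sup>2 + n)"
proof -
  interpret lie_algebra op_scale "Vec_SL n" "commutator :: (('k mat \<Rightarrow> 'k) \<Rightarrow> _) \<Rightarrow> _"
    by (rule lie_algebra_Vec_SL)
  show ?thesis
    unfolding bracket_width_def
  proof (rule SUP_least)
    fix z :: "('k mat \<Rightarrow> 'k) \<Rightarrow> 'k mat \<Rightarrow> 'k"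
    assume "z \<in> derived_algebra"
    moreover have "derived_algebra \<subseteq> (Vec_SL n :: (('k mat \<Rightarrow> 'k) \<Rightarrow> _) set)"
      unfolding derived_algebra_def
      by (rule span_minimal[OF _ subspace_carrier]) (auto intro: bracket_closed)
    ultimately have "z \<in> Vec_SL n" by blast
    \<comment> \<open>The bound \<open>n * n\<close> for arbitrary vector fields lies below the
      claimed \<open>n\<^sup>2 + n\<close>.\<close>
    then have "sum_of_brackets (n * n) z" using assms by (rule Vec_SL_sum_of_brackets)
    then have "bracket_length z \<le> n * n" unfolding bracket_length_def by (rule Least_le)
    then show "enat (bracket_length z) \<le> enat (n\<^sup>2 + n)" by (simp add: power2_eq_square)
  qed
qed

end
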